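(* If a region $R$ of the hexagonal grid $H$ has a signed tiling by stones, bones, and snakes, then its boundary matrix $M(R,v)$ equals $I$ or $-I$ (where $I$ is the $2\times 2$ identity matrix), for any vertex $v$ on the boundary of $R$. In particular, $M(R,v)=\pm I$ is a necessary condition for $R$ to be signed tilable by stones, bones, and snakes.
   Context: Let $H$ be the regular hexagonal tiling of the plane, drawn so that every hexagon has a horizontal top edge and a horizontal bottom edge; every edge of $H$ is then horizontal, or runs southwest–northeast, or runs southeast–northwest. Orient and label the edges: each southwest–northeast edge is oriented northeast and labeled $\alpha$; each southeast–northwest edge is oriented northwest and labeled $\beta$; each horizontal edge is oriented westward and labeled $\gamma$. Let $\omega$ be a primitive cube root of unity and set $\alpha = \begin{bmatrix}\omega^7 & 0\\ 0 & \omega^5\end{bmatrix}$, $\beta = \begin{bmatrix}\omega^7 & \omega^3\\ 0 & \omega^5\end{bmatrix}$, $\gamma = \begin{bmatrix}\omega^5 & 0\\ \omega^3 & \omega^7\end{bmatrix}$. Traversing an edge in the direction of its orientation contributes its matrix; traversing it against its orientation contributes the inverse matrix. A region is a finite, connected, simply connected union of hexagons of $H$ whose boundary is a single closed loop in $H$. For a region $R$ and a vertex $v$ on its boundary, traverse the boundary of $R$ once counterclockwise starting and ending at $v$, meeting edges $e_1,\dots,e_n$ in order with contributed matrices $M_1,\dots,M_n$, and set $M(R,v)=M_n\cdots M_1$. Identify hexagons with their centers; let $u,w$ denote vectors from a hexagon center to an adjacent (edge-sharing) hexagon center. A bone is three hexagons with centers $p,p+u,p+2u$; a stone is three hexagons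 sharing a common vertex (centers $p,p+u,p+w$, $u,w$ at angle $60^\circ$); a snake is four hexagons with centers $p,p+u,p+u+w,p+2u+w$, $u,w$ at angle $60^\circ$ (an "S" shape). A signed tiling of a region $R$ is a finite collection of tiles (stones, bones, snakes), each assigned weight $+1$ or $-1$, such that for every hexagon $h$ of $H$ the sum of the weights of the tiles containing $h$ is $1$ if $h\subseteq R$ and $0$ otherwise.
   Formalization: Here ω is a primitive twelfth root of unity, not a primitive cube root: with a cube root the claim is false, since a single stone has, from a suitable boundary vertex, boundary matrix with rows (5, 8) and (8, 13), which is not I or -I. *)

theory Defs
  imports "HOL-Complex_Analysis.Winding_Numbers"
begin

text \<open>The hexagons have side length 1, and one of them is centred at 0. Corner \<open>k\<close> of a hexagon lies
  at angle \<open>60 k\<close> degrees from its centre, so the top and bottom edges are horizontal.\<close>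

definition hex_step :: "nat \<Rightarrow> complex" where
  "hex_step k = of_real (sqrt 3) * cis (pi / 6 + of_nat k * pi / 3)"

definition hex_steps :: "complex set" where
  "hex_steps = hex_step ` {..<6}"

definition hex_centers :: "complex set" where
  "hex_centers = {of_int a * hex_step 0 + of_int b * hex_step 1 | a b. True}"

definition hex_corner :: "complex \<Rightarrow> nat \<Rightarrow> complex" where
  "hex_corner c k = c + cis (of_nat k * pi / 3)"

definition hexagon :: "complex \<Rightarrow> complex set" where
  "hexagon c = convex hull (hex_corner c ` {..<6})"

definition hex_edge :: "complex \<Rightarrow> complex \<Rightarrow> bool" where
  "hex_edge x y \<longleftrightarrow>
     (\<exists>c\<in>hex_centers. \<exists>k<6. {x, y} = {hex_corner c k, hex_corner c (Suc k)})"

text \<open>A walk along edges of the tiling is given by the list \<open>[v\<^sub>0, \<dots>, v\<^sub>n]\<close> of its vertices.\<close>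

fun polyline :: "complex list \<Rightarrow> real \<Rightarrow> complex" where
  "polyline [] = linepath 0 0"
| "polyline [x] = linepath x x"
| "polyline [x, y] = linepath x y"
| "polyline (x # y # z # zs) = linepath x y +++ polyline (y # z # zs)"

definition hex_loop :: "complex list \<Rightarrow> bool" where
  "hex_loop vs \<longleftrightarrow> vs \<noteq> [] \<and> successively hex_edge vs \<and> last vs = hd vs \<and> simple_path (polyline vs)"

definition boundary_loop :: "complex set \<Rightarrow> complex list \<Rightarrow> bool" where
  "boundary_loop R vs \<longleftrightarrow> hex_loop vs \<and> path_image (polyline vs) = frontier R"

definition hex_region :: "complex set \<Rightarrow> bool" where
  "hex_region R \<longleftrightarrow>
     (\<exists>S. finite S \<and> S \<subseteq> hex_centers \<and> R = (\<Union>c\<in>S. hexagon c)) \<and>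
     connected R \<and> simply_connected R \<and> (\<exists>vs. boundary_loop R vs)"

definition ccw_traversal :: "complex set \<Rightarrow> complex \<Rightarrow> complex list \<Rightarrow> bool" where
  "ccw_traversal R v vs \<longleftrightarrow>
     boundary_loop R vs \<and> hd vs = v \<and>
     (\<forall>z\<in>inside (path_image (polyline vs)). winding_number (polyline vs) z = 1)"

definition primitive_root_of_unity :: "nat \<Rightarrow> complex \<Rightarrow> bool" where
  "primitive_root_of_unity n z \<longleftrightarrow> 0 < n \<and> z ^ n = 1 \<and> (\<forall>k. 0 < k \<and> k < n \<longrightarrow> z ^ k \<noteq> 1)"

definition alpha_matrix :: "complex \<Rightarrow> complex^2^2" where
  "alpha_matrix \<omega> = vector [vector [\<omega>^7, 0], vector [0, \<omega>^5]]"

definition beta_matrix :: "complex \<Rightarrow> complex^2^2" where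
  "beta_matrix \<omega> = vector [vector [\<omega>^7, \<omega>^3], vector [0, \<omega>^5]]"

definition gamma_matrix :: "complex \<Rightarrow> complex^2^2" where
  "gamma_matrix \<omega> = vector [vector [\<omega>^5, 0], vector [\<omega>^3, \<omega>^7]]"

text \<open>These matrices are used with \<open>\<omega>\<close> a primitive twelfth root of unity. With a primitive cube root the
  boundary matrix of a single stone, for a suitable starting vertex, has rows \<open>(5, 8)\<close> and \<open>(8, 13)\<close>.\<close>

text \<open>The argument \<open>d\<close> is the displacement along a traversed edge; the last case is junk.\<close>

definition edge_matrix :: "complex \<Rightarrow> complex \<Rightarrow> complex^2^2" where
  "edge_matrix \<omega> d =
     (if d = cis (pi / 3) then alpha_matrix \<omega>
      else if d = cis (2 * pi / 3) then beta_matrix \<omega>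
      else if d = - 1 then gamma_matrix \<omega>
      else if d = - cis (pi / 3) then matrix_inv (alpha_matrix \<omega>)
      else if d = - cis (2 * pi / 3) then matrix_inv (beta_matrix \<omega>)
      else if d = 1 then matrix_inv (gamma_matrix \<omega>)
      else mat 1)"

text \<open>Later edges multiply on the left: the value is \<open>M\<^sub>n \<cdots> M\<^sub>1\<close>.\<close>

fun walk_matrix :: "complex \<Rightarrow> complex list \<Rightarrow> complex^2^2" where
  "walk_matrix \<omega> (x # y # zs) = walk_matrix \<omega> (y # zs) ** edge_matrix \<omega> (y - x)"
| "walk_matrix \<omega> _ = mat 1"

text \<open>Tiles are sets of hexagon centres.\<close>

definition angle60 :: "complex \<Rightarrow> complex \<Rightarrow> bool" where
  "angle60 u w \<longleftrightarrow> u \<in> hex_steps \<and> w \<in> hex_steps \<and> (w = cis (pi / 3) * u \<or> u = cis (pi / 3) * w)"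

definition bones :: "complex set set" where
  "bones = {{p, p + u, p + 2 * u} | p u. p \<in> hex_centers \<and> u \<in> hex_steps}"

definition stones :: "complex set set" where
  "stones = {{p, p + u, p + w} | p u w. p \<in> hex_centers \<and> angle60 u w}"

definition snakes :: "complex set set" where
  "snakes = {{p, p + u, p + u + w, p + 2 * u + w} | p u w. p \<in> hex_centers \<and> angle60 u w}"

text \<open>A multiset, since the same tile may be used several times.\<close>

definition signed_tiling :: "(complex set \<times> int) multiset \<Rightarrow> complex set \<Rightarrow> bool" where
  "signed_tiling \<T> R \<longleftrightarrow>
     (\<forall>(T, \<epsilon>)\<in>#\<T>. T \<in> stones \<union> bones \<union> snakes \<and> \<epsilon> \<in> {1, - 1}) \<and>
     (\<forall>h\<in>hex_centers.
        (\<Sum>(T, \<epsilon>)\<in>#\<T>. if h \<in> T then \<epsilon> else 0) = (if hexagon h \<subseteq> R then 1 else 0))"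

end

theory Submission
  imports Defs
begin

text \<open>Colour the hexagons by their row modulo 3. After a change of gauge at the vertices, every edge labelled
  \<open>\<alpha>\<close> or \<open>\<gamma>\<close> contributes \<open>\<plusminus>I\<close>, and a \<open>\<beta>\<close> edge contributes, up to sign, one of the quaternion units
  \<open>i\<close>, \<open>j\<close>, \<open>ij\<close>, depending only on the colour of the hexagon to its left. Modulo sign these units form
  a Klein four-group, so the boundary matrix is \<open>\<plusminus>I\<close> as soon as the signed numbers of \<open>\<beta>\<close> edges of the three
  colours have the same parity.

  A discrete form of Stokes' theorem computes these numbers: the net number of traversals of the \<open>\<beta>\<close>
  edge between two neighbouring hexagons of a row is the difference of the winding numbers about their
  centres, and these are 1 on the region and 0 elsewhere. Hence it suffices that, for each colour, the
  region has an even number of hexagons of the other two colours. Every stone and bone meets each colour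
  once and every snake meets two colours twice, so this parity is even for each tile and therefore for every region
  with a signed tiling.\<close>

subsection \<open>The edge matrices modulo sign\<close>

definition mat22 :: "complex \<Rightarrow> complex \<Rightarrow> complex \<Rightarrow> complex \<Rightarrow> complex^2^2" where
  "mat22 a b c d = vector [vector [a, b], vector [c, d]]"

lemma mat22_mult:
  "mat22 a b c d ** mat22 a' b' c' d' =
     mat22 (a * a' + b * c') (a * b' + b * d') (c * a' + d * c') (c * b' + d * d')"
  by (simp add: mat22_def vec_eq_iff forall_2 matrix_matrix_mult_def sum_2)

lemma mat22_eq_iff:
  "mat22 a b c d = mat22 a' b' c' d' \<longleftrightarrow> a = a' \<and> b = b' \<and> c = c' \<and> d = d'"
  by (auto simp: mat22_def vec_eq_iff forall_2)

lemma uminus_mat22: "- mat22 a b c d = mat22 (- a) (- b) (- c) (- d)"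
  by (simp add: mat22_def vec_eq_iff forall_2)

lemma mat_1_eq_mat22: "mat 1 = mat22 1 0 0 1"
  by (simp add: mat22_def vec_eq_iff forall_2 mat_def)

lemmas mat22_simps = mat22_mult mat22_eq_iff uminus_mat22 mat_1_eq_mat22

text \<open>\<open>matrix_inv\<close> is a choice term, so a two-sided inverse is exhibited first;
  for determinant 1 it is the adjugate.\<close>

lemma matrix_inv_mat22:
  assumes "a * d - b * c = 1"
  shows "matrix_inv (mat22 a b c d) = mat22 d (- b) (- c) a"
proof -
  let ?A = "mat22 a b c d" and ?B = "mat22 d (- b) (- c) a"
  have AB: "?A ** ?B = mat 1" "?B ** ?A = mat 1"
    using assms by (simp_all add: mat22_simps algebra_simps)
  have inv: "matrix_inv ?A ** ?A = mat 1"
    unfolding matrix_inv_def by (rule someI2 [where a = ?B]) (use AB in auto)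
  have "matrix_inv ?A = matrix_inv ?A ** (?A ** ?B)"
    by (simp add: AB)
  also have "\<dots> = (matrix_inv ?A ** ?A) ** ?B"
    by (simp only: matrix_mul_assoc)
  also have "\<dots> = ?B"
    by (simp add: inv)
  finally show ?thesis .
qed

section \<open>Equality of matrices up to sign\<close>

definition eq_upto_sign :: "complex^2^2 \<Rightarrow> complex^2^2 \<Rightarrow> bool"  (infix "\<simeq>" 50) where
  "A \<simeq> B \<longleftrightarrow> A = B \<or> A = - B"

lemma uminus_matrix_mult:
  fixes A B :: "complex^2^2"
  shows "(- A) ** B = - (A ** B)" "A ** (- B) = - (A ** B)"
  by (simp_all add: vec_eq_iff matrix_matrix_mult_def sum_negf)

lemma eq_upto_sign_refl [simp, intro]: "A \<simeq> A"
  by (simp add: eq_upto_sign_def)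

lemma eq_upto_sign_sym: "A \<simeq> B \<Longrightarrow> B \<simeq> A"
  by (auto simp: eq_upto_sign_def)

lemma eq_upto_sign_trans [trans]: "A \<simeq> B \<Longrightarrow> B \<simeq> C \<Longrightarrow> A \<simeq> C"
  by (auto simp: eq_upto_sign_def)

lemma eq_upto_sign_mult: "A \<simeq> B \<Longrightarrow> C \<simeq> D \<Longrightarrow> A ** C \<simeq> B ** D"
  by (auto simp: eq_upto_sign_def uminus_matrix_mult)

text \<open>In x^12 - 1 = (x^6 - 1)(x^2 + 1)(x^4 - x^2 + 1), primitivity keeps the first two factors
  nonzero at \<open>\<omega>\<close>; the third is the twelfth cyclotomic polynomial. All later
  matrix identities use only this quartic relation.\<close>

lemma primitive_root_12:
  assumes "primitive_root_of_unity 12 \<omega>"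
  shows "\<omega>^4 = \<omega>\<^sup>2 - 1"
proof -
  have ne: "\<omega>^4 \<noteq> 1" "\<omega>^6 \<noteq> 1" and "\<omega>^12 = 1"
    using assms by (auto simp: primitive_root_of_unity_def)
  have "(\<omega>^6 - 1) * ((\<omega>\<^sup>2 + 1) * (\<omega>^4 - \<omega>\<^sup>2 + 1)) = \<omega>^12 - 1"
    by algebra
  then have "(\<omega>^6 - 1) * ((\<omega>\<^sup>2 + 1) * (\<omega>^4 - \<omega>\<^sup>2 + 1)) = 0"
    using \<open>\<omega>^12 = 1\<close> by simp
  moreover have "\<omega>\<^sup>2 + 1 \<noteq> 0"
  proof
    assume "\<omega>\<^sup>2 + 1 = 0"
    then have "\<omega>\<^sup>2 = -1" by algebra
    then have "\<omega>^4 = 1" by algebra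
    with ne show False by simp
  qed
  ultimately show ?thesis
    using ne(2) by (simp add: algebra_simps) algebra
qed

lemma power_reduce_12:
  fixes \<omega> :: complex
  assumes "\<omega>^4 = \<omega>\<^sup>2 - 1"
  shows "\<omega>^5 = \<omega>^3 - \<omega>" "\<omega>^7 = - \<omega>"
  using assms by algebra+

lemma edge_matrices:
  assumes "\<omega>^4 = \<omega>\<^sup>2 - 1"
  shows "alpha_matrix \<omega> = mat22 (- \<omega>) 0 0 (\<omega>^3 - \<omega>)"
    and "beta_matrix \<omega> = mat22 (- \<omega>) (\<omega>^3) 0 (\<omega>^3 - \<omega>)"
    and "gamma_matrix \<omega> = mat22 (\<omega>^3 - \<omega>) 0 (\<omega>^3) (- \<omega>)"
  by (simp_all add: alpha_matrix_def beta_matrix_def gamma_matrix_def mat22_def power_reduce_12 [OF assms])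

lemma edge_matrix_inverses:
  assumes "\<omega>^4 = \<omega>\<^sup>2 - 1"
  shows "matrix_inv (alpha_matrix \<omega>) = mat22 (\<omega>^3 - \<omega>) 0 0 (- \<omega>)"
    and "matrix_inv (beta_matrix \<omega>) = mat22 (\<omega>^3 - \<omega>) (- (\<omega>^3)) 0 (- \<omega>)"
    and "matrix_inv (gamma_matrix \<omega>) = mat22 (- \<omega>) 0 (- (\<omega>^3)) (\<omega>^3 - \<omega>)"
proof -
  have *: "- \<omega> * (\<omega>^3 - \<omega>) = 1" using assms by algebra
  show "matrix_inv (alpha_matrix \<omega>) = mat22 (\<omega>^3 - \<omega>) 0 0 (- \<omega>)"
    and "matrix_inv (beta_matrix \<omega>) = mat22 (\<omega>^3 - \<omega>) (- (\<omega>^3)) 0 (- \<omega>)"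
    and "matrix_inv (gamma_matrix \<omega>) = mat22 (- \<omega>) 0 (- (\<omega>^3)) (\<omega>^3 - \<omega>)"
    unfolding edge_matrices [OF assms]
    by (subst matrix_inv_mat22; use * in \<open>simp add: mat22_eq_iff mult.commute\<close>)+
qed

text \<open>Like \<open>quat_i\<close>, this matrix has trace 0 and, by the quartic relation,
  determinant 1, so its square is -I; the two anticommute.\<close>

definition quat_j :: "complex \<Rightarrow> complex^2^2" where
  "quat_j \<omega> = mat22 (- (\<omega>\<^sup>2)) (\<omega>\<^sup>2) (- 1) (\<omega>\<^sup>2)"

definition quat_i :: "complex \<Rightarrow> complex^2^2" where
  "quat_i \<omega> = mat22 0 (\<omega>\<^sup>2 - 1) (\<omega>\<^sup>2) 0"

text \<open>Only the parities of the exponents matter modulo sign. They are integers because they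
  will be net crossing numbers, which can be negative.\<close>

definition quat :: "complex \<Rightarrow> int \<Rightarrow> int \<Rightarrow> complex^2^2" where
  "quat \<omega> a b = (if even a then mat 1 else quat_i \<omega>) ** (if even b then mat 1 else quat_j \<omega>)"

lemma quat_mult:
  assumes "\<omega>^4 = \<omega>\<^sup>2 - 1"
  shows "quat \<omega> a b ** quat \<omega> c d \<simeq> quat \<omega> (a + c) (b + d)"
proof -
  define I where "I a = (if even a then mat 1 else quat_i \<omega>)" for a :: int
  define J where "J a = (if even a then mat 1 else quat_j \<omega>)" for a :: int
  have ii: "quat_i \<omega> ** quat_i \<omega> = - mat 1"
    and jj: "quat_j \<omega> ** quat_j \<omega> = - mat 1"
    and ji: "quat_j \<omega> ** quat_i \<omega> = - (quat_i \<omega> ** quat_j \<omega>)"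
    unfolding quat_i_def quat_j_def mat22_simps by (safe; (simp; fail)?; use assms in algebra)+
  have I: "I a ** I c \<simeq> I (a + c)" and J: "J b ** J d \<simeq> J (b + d)" and JI: "J b ** I c \<simeq> I c ** J b"
    by (auto simp: I_def J_def ii jj ji eq_upto_sign_def)
  have "(I a ** J b) ** (I c ** J d) = I a ** ((J b ** I c) ** J d)"
    by (simp add: matrix_mul_assoc)
  also have "\<dots> \<simeq> I a ** ((I c ** J b) ** J d)"
    by (intro eq_upto_sign_mult JI eq_upto_sign_refl)
  also have "\<dots> = (I a ** I c) ** (J b ** J d)"
    by (simp add: matrix_mul_assoc)
  also have "\<dots> \<simeq> I (a + c) ** J (b + d)"
    by (intro eq_upto_sign_mult I J)
  finally show ?thesis
    by (simp add: quat_def I_def J_def)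
qed

text \<open>The values are the powers 0, 1, 2 of \<open>\<alpha>\<gamma>\<^sup>-\<^sup>1\<close>, whose cube is \<open>-I\<close>.\<close>

definition gauge_row :: "complex \<Rightarrow> int \<Rightarrow> complex^2^2" where
  "gauge_row \<omega> y =
     (if y mod 3 = 0 then mat22 1 0 0 1
      else if y mod 3 = 1 then mat22 (\<omega>\<^sup>2) 0 (\<omega>\<^sup>2) (1 - \<omega>\<^sup>2)
      else mat22 (\<omega>\<^sup>2 - 1) 0 (\<omega>\<^sup>2) (- (\<omega>\<^sup>2)))"

text \<open>Reduction modulo the twelfth cyclotomic polynomial, in the form to which \<open>algebra_simps\<close> brings powers.\<close>

lemma quartic_normalize:
  fixes \<omega> :: complex
  assumes "\<omega>^4 = \<omega>\<^sup>2 - 1"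
  shows "\<omega> * (\<omega> * (\<omega> * \<omega>)) = \<omega> * \<omega> - 1"
    and "\<omega> * (\<omega> * (\<omega> * (\<omega> * z))) = \<omega> * (\<omega> * z) - z"
  using assms by algebra+

text \<open>Up to sign, \<open>gauge_row \<omega> y\<close> is \<alpha>\<gamma>^-1 times
  \<open>gauge_row \<omega> (y - 1)\<close>; the wrap-around from residue 2 to residue 0 costs only
  a sign, as the cube is -I.\<close>

lemma gauge_alpha:
  assumes "\<omega>^4 = \<omega>\<^sup>2 - 1"
  shows "matrix_inv (alpha_matrix \<omega>) ** gauge_row \<omega> y \<simeq> matrix_inv (gamma_matrix \<omega>) ** gauge_row \<omega> (y - 1)"
proof -
  have "y mod 3 = 0 \<and> (y - 1) mod 3 = 2 \<or> y mod 3 = 1 \<and> (y - 1) mod 3 = 0 \<or> y mod 3 = 2 \<and> (y - 1) mod 3 = 1"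
    by presburger
  then show ?thesis
    unfolding edge_matrix_inverses [OF assms] gauge_row_def eq_upto_sign_def
    by (elim disjE conjE)
      (simp_all add: mat22_simps algebra_simps eval_nat_numeral quartic_normalize [OF assms])
qed

text \<open>Rows congruent to 0, 1, 2 modulo 3 receive ij, j, i. Writing both exponents as
  indicators of avoiding one residue turns products of defects into two sums over hexagons.\<close>

definition beta_defect :: "complex \<Rightarrow> int \<Rightarrow> complex^2^2" where
  "beta_defect \<omega> y = quat \<omega> (of_bool (y mod 3 \<noteq> 1)) (of_bool (y mod 3 \<noteq> 2))"

lemma gauge_beta:
  assumes "\<omega>^4 = \<omega>\<^sup>2 - 1"
  shows "beta_matrix \<omega> ** gauge_row \<omega> y \<simeq>
    (matrix_inv (gamma_matrix \<omega>) ** gauge_row \<omega> (y + 1)) ** beta_defect \<omega> y"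
proof -
  have "y mod 3 = 0 \<and> (y + 1) mod 3 = 1 \<or> y mod 3 = 1 \<and> (y + 1) mod 3 = 2 \<or> y mod 3 = 2 \<and> (y + 1) mod 3 = 0"
    by presburger
  then show ?thesis
    unfolding edge_matrix_inverses [OF assms] eq_upto_sign_def
    unfolding edge_matrices [OF assms] gauge_row_def beta_defect_def quat_def quat_i_def quat_j_def
    by (elim disjE conjE)
      (simp_all add: mat22_simps algebra_simps eval_nat_numeral quartic_normalize [OF assms])
qed

text \<open>Traversing an edge backwards should invert its defect \<open>Q\<close>; since
  \<open>Q\<close> is an involution modulo sign, the same defect serves both directions.\<close>

lemma reverse_step:
  assumes "N ** M = mat 1" "M ** X \<simeq> Y ** Q" "Q ** Q \<simeq> mat 1"
  shows "N ** Y \<simeq> X ** Q"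
proof -
  have "N ** Y \<simeq> (N ** Y) ** (Q ** Q)"
    by (metis assms(3) eq_upto_sign_mult eq_upto_sign_refl eq_upto_sign_sym matrix_mul_rid)
  also have "\<dots> = N ** (Y ** Q) ** Q"
    by (simp add: matrix_mul_assoc)
  also have "\<dots> \<simeq> N ** (M ** X) ** Q"
    by (intro eq_upto_sign_mult eq_upto_sign_refl eq_upto_sign_sym [OF assms(2)])
  also have "\<dots> = X ** Q"
    by (metis assms(1) matrix_mul_assoc matrix_mul_lid)
  finally show ?thesis .
qed

subsection \<open>Lattice coordinates\<close>

text \<open>Centres and vertices are the points \<open>lat x y\<close>, and \<open>x - y\<close> modulo 3 tells them apart: it is 0
  for centres, and 1 or 2 for the two classes of vertices. An edge always joins the two classes.\<close>

definition lat :: "int \<Rightarrow> int \<Rightarrow> complex" where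
  "lat x y = of_int x + of_int y * cis (pi / 3)"

lemma Re_lat: "Re (lat x y) = of_int x + of_int y / 2"
  and Im_lat: "Im (lat x y) = of_int y * sqrt 3 / 2"
  by (simp_all add: lat_def cos_60 sin_60)

lemma lat_eq_iff: "lat x y = lat x' y' \<longleftrightarrow> x = x' \<and> y = y'"
  by (auto simp: complex_eq_iff Re_lat Im_lat)

lemma lat_arith:
  "lat x y + lat x' y' = lat (x + x') (y + y')"
  "lat x y - lat x' y' = lat (x - x') (y - y')"
  "- lat x y = lat (- x) (- y)"
  by (simp_all add: lat_def algebra_simps)

lemma cis_120: "cis (2 * pi / 3) = lat (- 1) 1"
  by (simp add: complex_eq_iff Re_lat Im_lat cos_120 sin_120)

lemma units_eq_lat:
  "cis (pi / 3) = lat 0 1" "cis (2 * pi / 3) = lat (- 1) 1" "1 = lat 1 0" "0 = lat 0 0"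
  by (simp_all add: cis_120) (simp_all add: lat_def)

lemma cis_shift: "cis (pi / 3 * (of_nat k + 3)) = - cis (pi / 3 * of_nat k)"
  by (simp add: complex_eq_iff distrib_left)

lemma cis_multiples:
  "cis (of_nat 0 * pi / 3) = lat 1 0"
  "cis (of_nat 1 * pi / 3) = lat 0 1"
  "cis (of_nat 2 * pi / 3) = lat (- 1) 1"
  "cis (of_nat 3 * pi / 3) = lat (- 1) 0"
  "cis (of_nat 4 * pi / 3) = lat 0 (- 1)"
  "cis (of_nat 5 * pi / 3) = lat 1 (- 1)"
  "cis (of_nat 6 * pi / 3) = lat 1 0"
  using cis_shift [of 0] cis_shift [of 1] cis_shift [of 2] cis_shift [of 3] cis_120
  by (simp_all add: mult.commute lat_arith flip: units_eq_lat(1,3))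
   (simp_all add: lat_def)

lemma hex_step_0: "hex_step 0 = lat 1 1"
  by (simp add: hex_step_def complex_eq_iff Re_lat Im_lat cos_30 sin_30)

lemma hex_step_eq: "hex_step k = lat 1 1 * cis (of_nat k * pi / 3)"
  by (simp add: hex_step_def cis_mult flip: hex_step_0)

lemma lat_mult: "lat x y * lat x' y' = lat (x * x' - y * y') (x * y' + y * x' + y * y')"
proof -
  have "cis (pi / 3) * cis (pi / 3) = cis (pi / 3) - 1"
    using lat_arith(2) [of 0 1 1 0] by (simp add: cis_mult cis_120 flip: units_eq_lat)
  then show ?thesis
    unfolding lat_def by (simp, algebra)
qed

lemma hex_step_lat:
  "hex_step 0 = lat 1 1" "hex_step 1 = lat (- 1) 2" "hex_step 2 = lat (- 2) 1"
  "hex_step 3 = lat (- 1) (- 1)" "hex_step 4 = lat 1 (- 2)" "hex_step 5 = lat 2 (- 1)"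
  unfolding hex_step_eq cis_multiples lat_mult by simp_all

lemma lessThan_6: "{..<6::nat} = {0, 1, 2, 3, 4, 5}"
  by auto

lemma hex_steps_lat:
  "hex_steps = {lat 1 1, lat (- 1) 2, lat (- 2) 1, lat (- 1) (- 1), lat 1 (- 2), lat 2 (- 1)}"
  by (simp only: hex_steps_def lessThan_6 image_insert image_empty hex_step_lat)

lemma hex_centers_lat: "hex_centers = {lat x y | x y. (x - y) mod 3 = 0}"
proof (intro equalityI subsetI)
  fix z assume "z \<in> hex_centers"
  then obtain a b where "z = of_int a * lat 1 1 + of_int b * lat (- 1) 2"
    by (auto simp: hex_centers_def hex_step_lat [simplified])
  then have "z = lat (a - b) (a + 2 * b)"
    by (simp add: lat_def algebra_simps)
  then show "z \<in> {lat x y | x y. (x - y) mod 3 = 0}"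
    by (intro CollectI exI [of _ "a - b"] exI [of _ "a + 2 * b"]) simp
next
  fix z assume "z \<in> {lat x y | x y. (x - y) mod 3 = 0}"
  then obtain x y where z: "z = lat x y" and "(x - y) mod 3 = 0"
    by auto
  then obtain b where "y = x + 3 * b"
    by (metis add_diff_cancel_left' diff_diff_eq2 dvd_def mod_0_imp_dvd minus_diff_eq mult_minus_right diff_add_cancel add.commute)
  then have "z = of_int (x + b) * lat 1 1 + of_int b * lat (- 1) 2"
    by (simp add: z lat_def algebra_simps)
  then show "z \<in> hex_centers"
    unfolding hex_centers_def hex_step_lat by blast
qed

lemma hex_corner_lat:
  "hex_corner (lat a b) 0 = lat (a + 1) b"
  "hex_corner (lat a b) 1 = lat a (b + 1)"
  "hex_corner (lat a b) 2 = lat (a - 1) (b + 1)"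
  "hex_corner (lat a b) 3 = lat (a - 1) b"
  "hex_corner (lat a b) 4 = lat a (b - 1)"
  "hex_corner (lat a b) 5 = lat (a + 1) (b - 1)"
  "hex_corner (lat a b) 6 = lat (a + 1) b"
  unfolding hex_corner_def cis_multiples lat_arith by simp_all

text \<open>A normal form: each edge is based at its end of class 1, from which only three
  displacements are possible. Later arguments treat these three and then a reversal.\<close>

lemma hex_edge_cases:
  assumes "hex_edge x y"
  obtains p q dp dq where "(p - q) mod 3 = 1" "(dp, dq) \<in> {(1, 0), (- 1, 1), (0, - 1)}"
    "x = lat p q \<and> y = lat (p + dp) (q + dq) \<or> y = lat p q \<and> x = lat (p + dp) (q + dq)"
proof -
  obtain c k where "c \<in> hex_centers" "k < 6" and xy: "{x, y} = {hex_corner c k, hex_corner c (Suc k)}"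
    using assms by (auto simp: hex_edge_def)
  then obtain a b where c: "c = lat a b" and ab: "(a - b) mod 3 = 0"
    by (auto simp: hex_centers_lat)
  consider "k = 0" | "k = 1" | "k = 2" | "k = 3" | "k = 4" | "k = 5"
    using \<open>k < 6\<close> by linarith
  then show thesis
  proof cases
    case 1
    then have "{x, y} = {lat (a + 1) b, lat a (b + 1)}"
      using xy hex_corner_lat [of a b] by (simp add: c eval_nat_numeral)
    moreover have "(a + 1 - b) mod 3 = 1"
      using ab by presburger
    ultimately show thesis
      using that [of "a + 1" b "- 1" 1] by (auto simp: doubleton_eq_iff)
  next
    case 2
    then have "{x, y} = {lat a (b + 1), lat (a - 1) (b + 1)}"
      using xy hex_corner_lat [of a b] by (simp add: c eval_nat_numeral)
    moreover have "(a - 1 - (b + 1)) mod 3 = 1"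
      using ab by presburger
    ultimately show thesis
      using that [of "a - 1" "b + 1" 1 0] by (auto simp: doubleton_eq_iff)
  next
    case 3
    then have "{x, y} = {lat (a - 1) (b + 1), lat (a - 1) b}"
      using xy hex_corner_lat [of a b] by (simp add: c eval_nat_numeral)
    moreover have "(a - 1 - (b + 1)) mod 3 = 1"
      using ab by presburger
    ultimately show thesis
      using that [of "a - 1" "b + 1" 0 "- 1"] by (auto simp: doubleton_eq_iff)
  next
    case 4
    then have "{x, y} = {lat (a - 1) b, lat a (b - 1)}"
      using xy hex_corner_lat [of a b] by (simp add: c eval_nat_numeral)
    moreover have "(a - (b - 1)) mod 3 = 1"
      using ab by presburger
    ultimately show thesis
      using that [of a "b - 1" "- 1" 1] by (auto simp: doubleton_eq_iff)
  next
    case 5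
    then have "{x, y} = {lat a (b - 1), lat (a + 1) (b - 1)}"
      using xy hex_corner_lat [of a b] by (simp add: c eval_nat_numeral)
    moreover have "(a - (b - 1)) mod 3 = 1"
      using ab by presburger
    ultimately show thesis
      using that [of a "b - 1" 1 0] by (auto simp: doubleton_eq_iff)
  next
    case 6
    then have "{x, y} = {lat (a + 1) (b - 1), lat (a + 1) b}"
      using xy hex_corner_lat [of a b] by (simp add: c eval_nat_numeral)
    moreover have "(a + 1 - b) mod 3 = 1"
      using ab by presburger
    ultimately show thesis
      using that [of "a + 1" b 0 "- 1"] by (auto simp: doubleton_eq_iff)
  qed
qed

text \<open>The floor here and in \<open>vertex_class\<close> merely converts to an integer: on
  lattice points its argument is already one, namely y here and x - y there.\<close>

definition lat_row :: "complex \<Rightarrow> int" where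
  "lat_row z = \<lfloor>2 * Im z / sqrt 3\<rfloor>"

definition vertex_class :: "complex \<Rightarrow> int" where
  "vertex_class z = \<lfloor>Re z - sqrt 3 * Im z\<rfloor> mod 3"

lemma lat_row_lat [simp]: "lat_row (lat x y) = y"
  by (simp add: lat_row_def Im_lat)

lemma vertex_class_lat [simp]: "vertex_class (lat x y) = (x - y) mod 3"
proof -
  have "Re (lat x y) - sqrt 3 * Im (lat x y) = of_int (x - y)"
    by (simp add: Re_lat Im_lat mult.left_commute [of "sqrt 3"])
  then show ?thesis
    by (simp only: vertex_class_def floor_of_int)
qed

text \<open>The edge from \<open>c + 1\<close> to \<open>c + cis (pi / 3)\<close> is the \<open>\<beta>\<close> edge between the hexagons centred at
  \<open>c\<close> and \<open>c + hex_step 0\<close>.\<close>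

definition crossing :: "complex \<Rightarrow> complex \<Rightarrow> complex \<Rightarrow> int" where
  "crossing c x y =
     (if x = c + 1 \<and> y = c + cis (pi / 3) then 1
      else if x = c + cis (pi / 3) \<and> y = c + 1 then - 1 else 0)"

fun net_crossing :: "complex \<Rightarrow> complex list \<Rightarrow> int" where
  "net_crossing c (x # y # zs) = crossing c x y + net_crossing c (y # zs)"
| "net_crossing c _ = 0"

lemma crossing_nonbeta:
  assumes "(x, y) = (lat p q, lat (p + dp) (q + dq)) \<or> (y, x) = (lat p q, lat (p + dp) (q + dq))"
    and "(dp, dq) \<noteq> (- 1, 1)" "(dp, dq) \<noteq> (1, - 1)"
  shows "crossing c x y = 0"
proof -
  have "y - x \<noteq> lat (- 1) 1" "y - x \<noteq> lat 1 (- 1)"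
    using assms by (auto simp: lat_arith lat_eq_iff)
  moreover have "c + cis (pi / 3) - (c + 1) = lat (- 1) 1" "c + 1 - (c + cis (pi / 3)) = lat 1 (- 1)"
    by (simp_all add: units_eq_lat lat_arith)
  ultimately show ?thesis
    unfolding crossing_def by metis
qed

lemma crossing_beta:
  "crossing c (lat p q) (lat (p - 1) (q + 1)) = of_bool (c = lat (p - 1) q)"
  "crossing c (lat (p - 1) (q + 1)) (lat p q) = - of_bool (c = lat (p - 1) q)"
proof -
  have "lat p q = c + 1 \<longleftrightarrow> c = lat (p - 1) q"
    "lat (p - 1) (q + 1) = c + cis (pi / 3) \<longleftrightarrow> c = lat (p - 1) q"
    "lat p q = c + cis (pi / 3) \<longleftrightarrow> c = lat p (q - 1)"
    "lat (p - 1) (q + 1) = c + 1 \<longleftrightarrow> c = lat (p - 2) (q + 1)"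
    by (auto simp: units_eq_lat lat_arith eq_diff_eq [symmetric] diff_eq_eq [symmetric] algebra_simps)
  then show "crossing c (lat p q) (lat (p - 1) (q + 1)) = of_bool (c = lat (p - 1) q)"
    "crossing c (lat (p - 1) (q + 1)) (lat p q) = - of_bool (c = lat (p - 1) q)"
    by (auto simp: crossing_def lat_eq_iff)
qed

section \<open>Gauge transport along walks\<close>

definition vertex_gauge :: "complex \<Rightarrow> complex \<Rightarrow> complex^2^2" where
  "vertex_gauge \<omega> z = (if vertex_class z = 1 then gauge_row \<omega> (lat_row z)
     else matrix_inv (gamma_matrix \<omega>) ** gauge_row \<omega> (lat_row z))"

text \<open>The product modulo sign of the \<open>beta_defect\<close> values of the centres in
  \<open>F\<close>, each taken \<open>n c\<close> times. The set \<open>F\<close> makes the sums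
  finite.\<close>

definition defect :: "complex \<Rightarrow> complex set \<Rightarrow> (complex \<Rightarrow> int) \<Rightarrow> complex^2^2" where
  "defect \<omega> F n = quat \<omega> (\<Sum>c\<in>{c\<in>F. lat_row c mod 3 \<noteq> 1}. n c) (\<Sum>c\<in>{c\<in>F. lat_row c mod 3 \<noteq> 2}. n c)"

lemma edge_matrix_lat:
  "edge_matrix \<omega> (lat 0 1) = alpha_matrix \<omega>"
  "edge_matrix \<omega> (lat (- 1) 1) = beta_matrix \<omega>"
  "edge_matrix \<omega> (lat (- 1) 0) = gamma_matrix \<omega>"
  "edge_matrix \<omega> (lat 0 (- 1)) = matrix_inv (alpha_matrix \<omega>)"
  "edge_matrix \<omega> (lat 1 (- 1)) = matrix_inv (beta_matrix \<omega>)"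
  "edge_matrix \<omega> (lat 1 0) = matrix_inv (gamma_matrix \<omega>)"
  by (simp_all add: edge_matrix_def units_eq_lat lat_arith lat_eq_iff)

lemma edge_matrix_reverse:
  assumes "\<omega>^4 = \<omega>\<^sup>2 - 1" "(dp, dq) \<in> {(1, 0), (- 1, 1), (0, - 1)}"
  shows "edge_matrix \<omega> (lat (- dp) (- dq)) ** edge_matrix \<omega> (lat dp dq) = mat 1"
proof -
  have "edge_matrix \<omega> (lat (- dp) (- dq)) ** edge_matrix \<omega> (lat dp dq) = mat22 1 0 0 1"
    using assms(2) edge_matrix_inverses [OF assms(1)] edge_matrices [OF assms(1)]
    by (auto simp: edge_matrix_lat mat22_simps)
      (simp_all add: algebra_simps eval_nat_numeral quartic_normalize [OF assms(1)])
  then show ?thesis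
    by (simp add: mat_1_eq_mat22)
qed

text \<open>Starting from class 1, a \<gamma> edge is trivial because \<open>vertex_gauge\<close>
  carries the factor \<gamma>^-1 at the other end; \<open>gauge_alpha\<close> and
  \<open>gauge_beta\<close> settle the other two directions.\<close>

lemma edge_gauge_forward:
  assumes \<omega>: "\<omega>^4 = \<omega>\<^sup>2 - 1" and "finite F" and pq: "(p - q) mod 3 = 1"
    and d: "(dp, dq) \<in> {(1, 0), (- 1, 1), (0, - 1)}" and "lat (p - 1) q \<in> F"
  shows "edge_matrix \<omega> (lat dp dq) ** vertex_gauge \<omega> (lat p q) \<simeq>
    vertex_gauge \<omega> (lat (p + dp) (q + dq)) ** defect \<omega> F (\<lambda>c. crossing c (lat p q) (lat (p + dp) (q + dq)))"
proof -
  have cls: "(p + dp - (q + dq)) mod 3 = 2"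
    using pq d by (auto; presburger)
  let ?n = "\<lambda>c. crossing c (lat p q) (lat (p + dp) (q + dq))"
  show ?thesis
  proof (cases "(dp, dq) = (- 1, 1)")
    case True
    \<comment> \<open>Only the summand at \<open>lat (p - 1) q\<close> is nonzero, and that centre
      lies in row \<open>q\<close>.\<close>
    then have "defect \<omega> F ?n = beta_defect \<omega> q"
      using assms by (simp add: defect_def beta_defect_def crossing_beta)
    then show ?thesis
      using True gauge_beta [OF \<omega>, of q] cls pq
      by (simp add: vertex_gauge_def edge_matrix_lat)
  next
    case False
    then have "?n = (\<lambda>c. 0)"
      using d by (intro ext crossing_nonbeta [where dp = dp and dq = dq]) auto
    then have "defect \<omega> F ?n = mat 1"
      by (simp add: defect_def quat_def)
    then show ?thesis
      using False d gauge_alpha [OF \<omega>, of q] cls pq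
      by (auto simp: vertex_gauge_def edge_matrix_lat)
  qed
qed

lemma defect_square:
  assumes "\<omega>^4 = \<omega>\<^sup>2 - 1"
  shows "defect \<omega> F n ** defect \<omega> F n \<simeq> mat 1"
  using quat_mult [OF assms] unfolding defect_def
  by (rule eq_upto_sign_trans) (simp add: quat_def)

lemma defect_mult:
  assumes "\<omega>^4 = \<omega>\<^sup>2 - 1"
  shows "defect \<omega> F m ** defect \<omega> F n \<simeq> defect \<omega> F (\<lambda>c. m c + n c)"
  unfolding defect_def sum.distrib by (rule quat_mult [OF assms])

lemma crossing_swap: "crossing c y x = - crossing c x y"
  by (simp add: crossing_def add_left_cancel units_eq_lat lat_eq_iff)

lemma defect_uminus: "defect \<omega> F (\<lambda>c. - n c) = defect \<omega> F n"
  by (simp add: defect_def sum_negf quat_def)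

lemma edge_gauge:
  assumes \<omega>: "\<omega>^4 = \<omega>\<^sup>2 - 1" and "finite F" and "hex_edge x y"
    and F: "{x - 1, y - 1} \<inter> hex_centers \<subseteq> F"
  shows "edge_matrix \<omega> (y - x) ** vertex_gauge \<omega> x \<simeq> vertex_gauge \<omega> y ** defect \<omega> F (\<lambda>c. crossing c x y)"
  using \<open>hex_edge x y\<close>
proof (cases rule: hex_edge_cases)
  case (1 p q dp dq)
  let ?y = "lat (p + dp) (q + dq)"
  \<comment> \<open>Subtracting 1 from the end of class 1 gives a hexagon centre; as either of
    \<open>x\<close> and \<open>y\<close> may be that end, the condition on \<open>F\<close> covers
    both.\<close>
  have "lat (p - 1) q = lat p q - 1" "lat (p - 1) q \<in> hex_centers"
    using 1(1) by (simp_all add: units_eq_lat lat_arith hex_centers_lat lat_eq_iff) presburger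
  then have "lat (p - 1) q \<in> F"
    using F 1(3) by auto
  note fwd = edge_gauge_forward [OF \<omega> \<open>finite F\<close> 1(1,2) this]
  from 1(3) show ?thesis
  proof
    assume "x = lat p q \<and> y = ?y"
    then show ?thesis
      using fwd by (simp add: lat_arith)
  next
    assume "y = lat p q \<and> x = ?y"
    then show ?thesis
      using reverse_step [OF edge_matrix_reverse [OF \<omega> 1(2)] fwd defect_square [OF \<omega>]]
      by (simp add: lat_arith crossing_swap [of _ _ ?y] defect_uminus)
  qed
qed

text \<open>The gauges at inner vertices telescope, and the defects, which multiply like a Klein
  four-group modulo sign, accumulate on the right.\<close>

lemma walk_gauge:
  assumes \<omega>: "\<omega>^4 = \<omega>\<^sup>2 - 1" and "finite F" and "successively hex_edge vs" and "vs \<noteq> []"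
    and F: "(\<lambda>z. z - 1) ` set vs \<inter> hex_centers \<subseteq> F"
  shows "walk_matrix \<omega> vs ** vertex_gauge \<omega> (hd vs) \<simeq> vertex_gauge \<omega> (last vs) ** defect \<omega> F (\<lambda>c. net_crossing c vs)"
  using assms(3-5)
proof (induction vs rule: induct_list012)
  case (3 x y zs)
  let ?W = "walk_matrix \<omega> (y # zs)" and ?D = "\<lambda>n. defect \<omega> F n"
    and ?m = "\<lambda>c. net_crossing c (y # zs)" and ?n = "\<lambda>c. crossing c x y"
  have edge: "edge_matrix \<omega> (y - x) ** vertex_gauge \<omega> x \<simeq> vertex_gauge \<omega> y ** ?D ?n"
    using 3 by (intro edge_gauge [OF \<omega> \<open>finite F\<close>]) auto
  have IH: "?W ** vertex_gauge \<omega> y \<simeq> vertex_gauge \<omega> (last (y # zs)) ** ?D ?m"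
  proof -
    have "(\<lambda>z. z - 1) ` set (y # zs) \<inter> hex_centers \<subseteq> F"
      using 3 by auto
    with 3 show ?thesis
      by (simp split del: if_split)
  qed
  have "(?W ** edge_matrix \<omega> (y - x)) ** vertex_gauge \<omega> x = ?W ** (edge_matrix \<omega> (y - x) ** vertex_gauge \<omega> x)"
    by (simp only: matrix_mul_assoc)
  also have "\<dots> \<simeq> ?W ** (vertex_gauge \<omega> y ** ?D ?n)"
    by (intro eq_upto_sign_mult eq_upto_sign_refl edge)
  also have "\<dots> = (?W ** vertex_gauge \<omega> y) ** ?D ?n"
    by (simp only: matrix_mul_assoc)
  also have "\<dots> \<simeq> (vertex_gauge \<omega> (last (y # zs)) ** ?D ?m) ** ?D ?n"
    by (intro eq_upto_sign_mult eq_upto_sign_refl IH)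
  also have "\<dots> = vertex_gauge \<omega> (last (y # zs)) ** (?D ?m ** ?D ?n)"
    by (simp only: matrix_mul_assoc)
  also have "\<dots> \<simeq> vertex_gauge \<omega> (last (y # zs)) ** ?D (\<lambda>c. ?m c + ?n c)"
    by (intro eq_upto_sign_mult eq_upto_sign_refl defect_mult [OF \<omega>])
  finally show ?case
    by (simp add: add.commute)
qed (auto simp: defect_def quat_def)

lemma gauge_right_inverse:
  assumes "\<omega>^4 = \<omega>\<^sup>2 - 1"
  obtains X where "vertex_gauge \<omega> z ** X = mat 1"
proof -
  have row_inv: "\<exists>X. gauge_row \<omega> y ** X = mat 1" for y
  proof -
    \<comment> \<open>The three values of \<open>gauge_row\<close> have determinant 1, so the
      witnesses are their adjugates.\<close>
    consider "y mod 3 = 0" | "y mod 3 = 1" | "y mod 3 = 2"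
      by linarith
    then show ?thesis
    proof cases
      case 1
      then show ?thesis
        by (intro exI [of _ "mat 1"]) (simp add: gauge_row_def mat22_simps)
    next
      case 2
      then show ?thesis
        by (intro exI [of _ "mat22 (1 - \<omega>\<^sup>2) 0 (- (\<omega>\<^sup>2)) (\<omega>\<^sup>2)"])
          (simp add: gauge_row_def mat22_simps algebra_simps eval_nat_numeral quartic_normalize [OF assms])
    next
      case 3
      then show ?thesis
        by (intro exI [of _ "mat22 (- (\<omega>\<^sup>2)) 0 (- (\<omega>\<^sup>2)) (\<omega>\<^sup>2 - 1)"])
          (simp add: gauge_row_def mat22_simps algebra_simps eval_nat_numeral quartic_normalize [OF assms])
    qed
  qed
  then obtain X where X: "gauge_row \<omega> (lat_row z) ** X = mat 1"
    by blast
  have inv: "matrix_inv (gamma_matrix \<omega>) ** gamma_matrix \<omega> = mat 1"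
    using edge_matrix_reverse [OF assms, of "- 1" 0] edge_matrix_reverse [OF assms, of 1 0]
    by (simp add: edge_matrix_lat matrix_left_right_inverse)
  have "(matrix_inv (gamma_matrix \<omega>) ** gauge_row \<omega> (lat_row z)) ** (X ** gamma_matrix \<omega>) =
      matrix_inv (gamma_matrix \<omega>) ** (gauge_row \<omega> (lat_row z) ** X) ** gamma_matrix \<omega>"
    by (simp only: matrix_mul_assoc)
  then have "(matrix_inv (gamma_matrix \<omega>) ** gauge_row \<omega> (lat_row z)) ** (X ** gamma_matrix \<omega>) = mat 1"
    by (simp add: X inv)
  then show thesis
    using that X unfolding vertex_gauge_def by (cases "vertex_class z = 1") auto
qed

text \<open>On a closed walk the gauges at the two ends agree, and even exponents make the defect
  the identity; cancelling the gauge leaves the claim.\<close>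

lemma closed_walk_matrix:
  assumes \<omega>: "\<omega>^4 = \<omega>\<^sup>2 - 1" and "finite F" "successively hex_edge vs" "vs \<noteq> []" "last vs = hd vs"
    and "(\<lambda>z. z - 1) ` set vs \<inter> hex_centers \<subseteq> F"
    and "even (\<Sum>c\<in>{c\<in>F. lat_row c mod 3 \<noteq> 1}. net_crossing c vs)"
    and "even (\<Sum>c\<in>{c\<in>F. lat_row c mod 3 \<noteq> 2}. net_crossing c vs)"
  shows "walk_matrix \<omega> vs \<simeq> mat 1"
proof -
  obtain X where X: "vertex_gauge \<omega> (hd vs) ** X = mat 1"
    using gauge_right_inverse [OF \<omega>] .
  have "walk_matrix \<omega> vs ** vertex_gauge \<omega> (hd vs) \<simeq> vertex_gauge \<omega> (hd vs)"
    using walk_gauge [OF \<omega> assms(2,3,4,6)] assms(5,7,8) by (simp add: defect_def quat_def)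
  then have "(walk_matrix \<omega> vs ** vertex_gauge \<omega> (hd vs)) ** X \<simeq> vertex_gauge \<omega> (hd vs) ** X"
    by (rule eq_upto_sign_mult) simp
  then show ?thesis
    by (simp add: X flip: matrix_mul_assoc)
qed

subsection \<open>Crossings and winding numbers\<close>

text \<open>A quotient \<open>k\<close> with k \<le> 0 would make \<open>z\<close> the convex
  combination of \<open>a\<close> and \<open>w\<close> in which \<open>w\<close> has weight 1 / (1 -
  k), putting \<open>z\<close> on the segment.\<close>

lemma closed_segment_Ln_arg:
  fixes a b w z :: complex
  assumes "z \<notin> closed_segment a b" "w \<in> closed_segment a b"
  shows "(w - z) / (a - z) \<notin> \<real>\<^sub>\<le>\<^sub>0"
proof
  assume "(w - z) / (a - z) \<in> \<real>\<^sub>\<le>\<^sub>0"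
  then obtain k where k: "(w - z) / (a - z) = of_real k" "k \<le> 0"
    by (auto simp: nonpos_Reals_def)
  have "a \<noteq> z"
    using assms(1) by auto
  then have "w - z = of_real k * (a - z)"
    using k(1) by (simp add: divide_eq_eq)
  then have "w - of_real k * a = (1 - of_real k) * z"
    by (simp add: algebra_simps)
  moreover have "1 - complex_of_real k \<noteq> 0"
    using k(2) by (metis diff_eq_eq add_0 of_real_eq_1_iff not_one_le_zero)
  ultimately have "z = (w - of_real k * a) / (1 - of_real k)"
    by (simp add: eq_divide_eq mult.commute)
  moreover have "1 - 1 / (1 - k) = - k / (1 - k)"
    using k(2) by (simp add: field_simps)
  ultimately have "z = (1 - 1 / (1 - k)) *\<^sub>R a + (1 / (1 - k)) *\<^sub>R w"
    by (simp add: scaleR_conv_of_real diff_divide_distrib)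
  moreover have "0 \<le> 1 / (1 - k)" "1 / (1 - k) \<le> 1"
    using k(2) by (auto simp: field_simps)
  ultimately have "z \<in> closed_segment a w"
    unfolding in_segment by blast
  then show False
    using assms by (meson subset_closed_segment ends_in_segment(1) subsetD)
qed

text \<open>The function Ln ((w - z) / (a - z)) of \<open>w\<close> is a primitive of 1 / (w - z)
  along the whole segment, and it vanishes at \<open>a\<close>.\<close>

lemma winding_number_linepath_Ln:
  assumes "z \<notin> closed_segment a b"
  shows "2 * pi * \<i> * winding_number (linepath a b) z = Ln ((b - z) / (a - z))"
proof -
  have "a \<noteq> z"
    using assms by auto
  have "((\<lambda>w. Ln ((w - z) / (a - z))) has_field_derivative 1 / (w - z)) (at w within closed_segment a b)"
    if "w \<in> closed_segment a b" for w
  proof -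
    have "w \<noteq> z"
      using assms that by auto
    then show ?thesis
      using closed_segment_Ln_arg [OF assms that] \<open>a \<noteq> z\<close>
      by (auto intro!: derivative_eq_intros simp: divide_simps)
  qed
  then have "((\<lambda>w. 1 / (w - z)) has_contour_integral (Ln ((b - z) / (a - z)) - Ln ((a - z) / (a - z)))) (linepath a b)"
    using contour_integral_primitive [of "closed_segment a b" _ _ "linepath a b"] by fastforce
  moreover have "((\<lambda>w. 1 / (w - z)) has_contour_integral (2 * pi * \<i> * winding_number (linepath a b) z)) (linepath a b)"
    using assms by (intro has_contour_integral_winding_number) auto
  ultimately show ?thesis
    using \<open>a \<noteq> z\<close> by (auto dest: has_contour_integral_unique)
qed

text \<open>This places the branch cut of Ln ((z - l) / (z - r)) on the segment from
  \<open>l\<close> to \<open>r\<close>, so that off this segment it is a primitive of 1 / (z - l) -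
  1 / (z - r).\<close>

lemma segment_Ln_arg:
  fixes l r z :: complex
  assumes "z \<notin> closed_segment l r"
  shows "(z - l) / (z - r) \<notin> \<real>\<^sub>\<le>\<^sub>0"
proof -
  have "(r - z) / (l - z) \<notin> \<real>\<^sub>\<le>\<^sub>0"
    using closed_segment_Ln_arg [OF assms, of r] by simp
  moreover have "(z - l) / (z - r) = inverse ((r - z) / (l - z))"
    using minus_divide_divide [of "l - z" "r - z"] by simp
  ultimately show ?thesis
    by (simp only: nonpos_Reals_inverse_iff) simp
qed

lemma winding_number_linepath_diff:
  assumes "closed_segment x y \<inter> closed_segment l r = {}"
  shows "2 * pi * \<i> * (winding_number (linepath x y) l - winding_number (linepath x y) r) =
    Ln ((y - l) / (y - r)) - Ln ((x - l) / (x - r))"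
proof -
  have "((\<lambda>z. Ln ((z - l) / (z - r))) has_field_derivative 1 / (z - l) - 1 / (z - r)) (at z within closed_segment x y)"
    if "z \<in> closed_segment x y" for z
  proof -
    have z: "z \<notin> closed_segment l r"
      using assms that by auto
    then have "z \<noteq> l" "z \<noteq> r"
      by auto
    with segment_Ln_arg [OF z] show ?thesis
      by (auto intro!: derivative_eq_intros simp: divide_simps) 
  qed
  then have "((\<lambda>z. 1 / (z - l) - 1 / (z - r)) has_contour_integral
      (Ln ((y - l) / (y - r)) - Ln ((x - l) / (x - r)))) (linepath x y)"
    using contour_integral_primitive [of "closed_segment x y" "\<lambda>z. Ln ((z - l) / (z - r))" _ "linepath x y"] by simp
  moreover have "l \<notin> closed_segment x y" "r \<notin> closed_segment x y"
    using assms by auto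
  then have "((\<lambda>z. 1 / (z - l) - 1 / (z - r)) has_contour_integral
      (2 * pi * \<i> * winding_number (linepath x y) l - 2 * pi * \<i> * winding_number (linepath x y) r)) (linepath x y)"
    by (intro has_contour_integral_diff has_contour_integral_winding_number) auto
  ultimately show ?thesis
    by (auto dest: has_contour_integral_unique simp: right_diff_distrib)
qed

text \<open>The two expressions in \<open>z\<close> extend the lattice coordinates x and y of
  \<open>lat x y\<close> to the whole plane as real linear functions.\<close>

lemma lat_segment:
  assumes "z \<in> closed_segment (lat p q) (lat p' q')"
  obtains s :: real where "0 \<le> s" "s \<le> 1" "Re z - Im z / sqrt 3 = p + s * (p' - p)" "2 * Im z / sqrt 3 = q + s * (q' - q)"
proof -
  obtain s where s: "0 \<le> s" "s \<le> 1" and z: "z = (1 - s) *\<^sub>R lat p q + s *\<^sub>R lat p' q'"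
    using assms by (auto simp: in_segment)
  have "Re z - Im z / sqrt 3 = p + s * (p' - p)"
    by (simp add: z Im_lat Re_lat field_simps)
  moreover have "2 * Im z / sqrt 3 = q + s * (q' - q)"
    by (simp add: z Im_lat field_simps)
  ultimately show thesis
    using that [OF s] by simp
qed

text \<open>Along the segment of centres \<open>x - y\<close> is constant, and along an edge it is affine: this determines where they meet.\<close>

lemma edge_meets_diagonal:
  assumes pq: "(p - q) mod 3 = 1" and d: "(dp, dq) \<in> {(1, 0), (- 1, 1), (0, - 1)}" and ab: "(a - b) mod 3 = 0"
    and meet: "closed_segment (lat p q) (lat (p + dp) (q + dq)) \<inter> closed_segment (lat a b) (lat (a + 1) (b + 1)) \<noteq> {}"
  shows "p = a + 1" "q = b" "dp = - 1" "dq = 1"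
proof -
  obtain z where z: "z \<in> closed_segment (lat p q) (lat (p + dp) (q + dq))"
    "z \<in> closed_segment (lat a b) (lat (a + 1) (b + 1))"
    using meet by blast
  obtain s :: real where s: "0 \<le> s" "s \<le> 1" and zs: "Re z - Im z / sqrt 3 = p + s * dp" "2 * Im z / sqrt 3 = q + s * dq"
    by (rule lat_segment [OF z(1)]) simp
  obtain t :: real where t: "0 \<le> t" "t \<le> 1" and zt: "Re z - Im z / sqrt 3 = a + t" "2 * Im z / sqrt 3 = b + t"
    by (rule lat_segment [OF z(2)]) simp
  have eq: "real_of_int p + s * dp = a + t" "real_of_int q + s * dq = b + t"
    using zs zt by simp_all
  \<comment> \<open>In directions (1, 0) and (0, -1) the value of x - y rises by \<open>s\<close>
    from residue 1; reaching residue 0 would take an increase congruent to 2, but \<open>s\<close>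
    is at most 1.\<close>
  have nonint: False if "real_of_int k = s" "k mod 3 = 2" for k
  proof -
    have "0 \<le> k" "k \<le> 1"
      using that(1) s by linarith+
    then show False
      using that(2) by presburger
  qed
  have "p = a + 1 \<and> q = b \<and> dp = - 1 \<and> dq = 1"
    using d
  proof (elim insertE emptyE)
    assume "(dp, dq) = (1, 0)"
    then have "of_int (a - b - (p - q)) = s"
      using eq by simp
    moreover have "(a - b - (p - q)) mod 3 = 2"
      using pq ab by presburger
    ultimately show ?thesis
      using nonint by blast
  next
    assume "(dp, dq) = (0, - 1)"
    then have "of_int (a - b - (p - q)) = s"
      using eq by simp
    moreover have "(a - b - (p - q)) mod 3 = 2"
      using pq ab by presburger
    ultimately show ?thesis
      using nonint by blast
  next
    assume d: "(dp, dq) = (- 1, 1)"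
    \<comment> \<open>Here x - y falls by 2 s, and 1 is the only integer from 0 to 2 with residue 1,
      so the meeting point is the midpoint of the edge.\<close>
    then have *: "of_int (p - q - (a - b)) = 2 * s"
      using eq by simp
    then have "0 \<le> p - q - (a - b)" "p - q - (a - b) \<le> 2"
      using s by linarith+
    moreover have "(p - q - (a - b)) mod 3 = 1"
      using pq ab by presburger
    ultimately have 1: "p - q - (a - b) = 1"
      by presburger
    then have "s = 1 / 2"
      using * by simp
    then have "of_int (q - b) = t - 1 / 2"
      using eq d by simp
    then have "q = b"
      using t by linarith
    then show ?thesis
      using 1 d by simp
  qed
  then show "p = a + 1" "q = b" "dp = - 1" "dq = 1"
    by simp_all
qed

text \<open>A centre is an end of its own diagonal, so \<open>edge_meets_diagonal\<close> leaves a
  single candidate edge; on it the two coordinates would demand s = 0 and s = 1.\<close>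

lemma center_notin_edge:
  assumes "hex_edge x y" "c \<in> hex_centers"
  shows "c \<notin> closed_segment x y"
proof
  assume c: "c \<in> closed_segment x y"
  obtain a b where ab: "c = lat a b" "(a - b) mod 3 = 0"
    using assms(2) by (auto simp: hex_centers_lat)
  from assms(1) show False
  proof (cases rule: hex_edge_cases)
    case (1 p q dp dq)
    have seg: "c \<in> closed_segment (lat p q) (lat (p + dp) (q + dq))"
      using 1(3) c by (auto simp: closed_segment_commute)
    then have "p = a + 1" "q = b" "dp = - 1" "dq = 1"
      using edge_meets_diagonal [OF 1(1,2) ab(2)] ab(1) by auto
    with lat_segment [OF seg] obtain s where "of_int b = of_int b + s" "of_int a = of_int a + (1 :: real) - s"
      unfolding ab(1) Re_lat Im_lat by auto
    then show False
      by simp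
  qed
qed

text \<open>A primitive of \<open>1 / (z - c) - 1 / (z - (c + hex_step 0))\<close> whose branch cut is the segment joining the two centres,
  so that it jumps only along the \<open>\<beta>\<close> edge that crosses this segment.\<close>

definition wall_log :: "complex \<Rightarrow> complex \<Rightarrow> complex" where
  "wall_log c z = Ln ((z - c) / (z - (c + hex_step 0)))"

lemma add_hex_step_0_center: "c \<in> hex_centers \<Longrightarrow> c + hex_step 0 \<in> hex_centers"
  by (force simp: hex_centers_lat hex_step_0 lat_arith lat_eq_iff)

text \<open>If the edge avoids the segment joining the two centres, \<open>wall_log c\<close> is a
  primitive along it and nothing is crossed. Otherwise \<open>edge_meets_diagonal\<close> identifies
  the edge and all terms are explicit.\<close>

lemma winding_diff_edge_forward:
  assumes pq: "(p - q) mod 3 = 1" and d: "(dp, dq) \<in> {(1, 0), (- 1, 1), (0, - 1)}" and "c \<in> hex_centers"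
  shows "2 * pi * \<i> * (winding_number (linepath (lat p q) (lat (p + dp) (q + dq))) c
        - winding_number (linepath (lat p q) (lat (p + dp) (q + dq))) (c + hex_step 0)) =
      wall_log c (lat (p + dp) (q + dq)) - wall_log c (lat p q)
        + 2 * pi * \<i> * of_int (crossing c (lat p q) (lat (p + dp) (q + dq)))"
proof -
  obtain a b where c: "c = lat a b" and ab: "(a - b) mod 3 = 0"
    using assms(3) by (auto simp: hex_centers_lat)
  let ?x = "lat p q" and ?y = "lat (p + dp) (q + dq)"
  show ?thesis
  proof (cases "closed_segment ?x ?y \<inter> closed_segment c (c + hex_step 0) = {}")
    case True
    have "crossing c ?x ?y = 0"
    proof (cases "(dp, dq) = (- 1, 1)")
      case False
      then show ?thesis
        using d by (intro crossing_nonbeta [where dp = dp and dq = dq]) auto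
    next
      case d: True
      have "c \<noteq> lat (p - 1) q"
      proof
        assume c': "c = lat (p - 1) q"
        \<comment> \<open>The \<beta> edge and the segment of centres bisect each other, so this
          edge could not be disjoint from the segment.\<close>
        have "midpoint ?x ?y = midpoint c (c + hex_step 0)"
          using d by (simp add: c' hex_step_0 lat_arith midpoint_def)
        moreover have "midpoint ?x ?y \<in> closed_segment ?x ?y"
          "midpoint c (c + hex_step 0) \<in> closed_segment c (c + hex_step 0)"
          by simp_all
        ultimately show False
          using True by auto
      qed
      then show ?thesis
        using d by (simp add: crossing_beta)
    qed
    with winding_number_linepath_diff [OF True] show ?thesis
      by (simp add: wall_log_def)
  next
    case False
    then have eqs: "p = a + 1" "q = b" "dp = - 1" "dq = 1"
      using edge_meets_diagonal [OF pq d ab] by (auto simp: c hex_step_0 lat_arith)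
    have "hex_edge ?x ?y"
      using assms(3) unfolding hex_edge_def
      by (intro bexI [of _ c] exI [of _ 0]) (use eqs hex_corner_lat [of a b] in \<open>auto simp: c\<close>)
    then have notin: "c \<notin> closed_segment ?x ?y" "c + hex_step 0 \<notin> closed_segment ?x ?y"
      using center_notin_edge assms(3) add_hex_step_0_center by blast+
    have diffs: "?x - c = 1" "?y - c = cis (pi / 3)" "?x - (c + hex_step 0) = - cis (pi / 3)" "?y - (c + hex_step 0) = - 1"
      by (simp_all add: c eqs hex_step_0 lat_arith units_eq_lat lat_eq_iff)
    \<comment> \<open>The edge subtends the angle pi/3 at \<open>c\<close> and -pi/3 at the other
      centre, 2 pi/3 in all, while \<open>wall_log c\<close> changes by -4 pi/3 times the imaginary
      unit; the gap of 2 pi is the crossing term.\<close>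
    have wl: "2 * pi * \<i> * winding_number (linepath ?x ?y) c = \<i> * (pi / 3)"
      using winding_number_linepath_Ln [OF notin(1)] by (simp add: diffs Ln_cis)
    have "- 1 / (- cis (pi / 3)) = cis (- (pi / 3))"
      using cis_divide [of 0 "pi / 3"] by simp
    then have wr: "2 * pi * \<i> * winding_number (linepath ?x ?y) (c + hex_step 0) = - \<i> * (pi / 3)"
      using winding_number_linepath_Ln [OF notin(2)]
        Ln_cis [of "- (pi / 3)"] pi_gt_zero
      by (simp only: diffs) (simp add: mult.commute)
    have fx: "wall_log c ?x = \<i> * (2 * pi / 3)"
    proof -
      have "1 / (- cis (pi / 3)) = cis (2 * pi / 3)"
        using cis_mult [of "2 * pi / 3" "pi / 3"] by (simp add: field_simps)
      then show ?thesis
        unfolding wall_log_def diffs by (simp add: Ln_cis)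
    qed
    have fy: "wall_log c ?y = - \<i> * (2 * pi / 3)"
    proof -
      have "cis (pi / 3) / (- 1) = cis (- (2 * pi / 3))"
        by (simp add: complex_eq_iff cos_60 sin_60 cos_120 sin_120)
      then show ?thesis
        unfolding wall_log_def diffs
        using Ln_cis [of "- (2 * pi / 3)"] pi_gt_zero by (simp add: mult_ac)
    qed
    have cr: "crossing c ?x ?y = 1"
      using crossing_beta(1) [of c p q] by (simp add: eqs c)
    show ?thesis
      by (simp only: right_diff_distrib wl wr fx fy cr) simp
  qed
qed

lemma winding_diff_edge:
  assumes "hex_edge x y" and c: "c \<in> hex_centers"
  shows "2 * pi * \<i> * (winding_number (linepath x y) c - winding_number (linepath x y) (c + hex_step 0)) =
    wall_log c y - wall_log c x + 2 * pi * \<i> * of_int (crossing c x y)"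
proof -
  have notin: "c \<notin> closed_segment x y" "c + hex_step 0 \<notin> closed_segment x y"
    using center_notin_edge assms add_hex_step_0_center by blast+
  have rev: "winding_number (linepath y x) z = - winding_number (linepath x y) z" if "z \<notin> closed_segment x y" for z
    using that winding_number_reversepath [of "linepath x y" z] by simp
  from assms(1) show ?thesis
  proof (cases rule: hex_edge_cases)
    case (1 p q dp dq)
    note fwd = winding_diff_edge_forward [OF 1(1,2) c]
    from 1(3) show ?thesis
    proof
      assume "x = lat p q \<and> y = lat (p + dp) (q + dq)"
      then show ?thesis
        using fwd by simp
    next
      assume "y = lat p q \<and> x = lat (p + dp) (q + dq)"
      then have "2 * pi * \<i> * (winding_number (linepath y x) c - winding_number (linepath y x) (c + hex_step 0)) =
          wall_log c x - wall_log c y + 2 * pi * \<i> * of_int (crossing c y x)"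
        using fwd by simp
      then show ?thesis
        unfolding rev [OF notin(1)] rev [OF notin(2)] crossing_swap [of c y x]
        by (simp add: algebra_simps)
    qed
  qed
qed

section \<open>Polygonal paths: from single edges to closed loops\<close>

lemma path_polyline [simp]: "path (polyline vs)"
  and pathstart_polyline [simp]: "vs \<noteq> [] \<Longrightarrow> pathstart (polyline vs) = hd vs"
proof -
  have "path (polyline vs) \<and> (vs \<noteq> [] \<longrightarrow> pathstart (polyline vs) = hd vs)"
    by (induction vs rule: polyline.induct) (auto, simp_all add: path_def pathstart_def)
  then show "path (polyline vs)" "vs \<noteq> [] \<Longrightarrow> pathstart (polyline vs) = hd vs"
    by auto
qed

lemma pathfinish_polyline [simp]: "vs \<noteq> [] \<Longrightarrow> pathfinish (polyline vs) = last vs"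
  by (induction vs rule: polyline.induct) auto

text \<open>Shorter lists give constant paths, which may sit at a centre: \<open>polyline []\<close>
  stays at 0.\<close>

lemma center_notin_polyline:
  assumes "successively hex_edge vs" "c \<in> hex_centers" "length vs \<ge> 2"
  shows "c \<notin> path_image (polyline vs)"
  using assms by (induction vs rule: polyline.induct) (auto simp: path_image_join center_notin_edge)

text \<open>Winding numbers add over the edges while the \<open>wall_log\<close> terms
  telescope.\<close>

lemma winding_diff_polyline:
  assumes "successively hex_edge vs" "c \<in> hex_centers" "length vs \<ge> 2"
  shows "2 * pi * \<i> * (winding_number (polyline vs) c - winding_number (polyline vs) (c + hex_step 0)) =
    wall_log c (last vs) - wall_log c (hd vs) + 2 * pi * \<i> * of_int (net_crossing c vs)"
  using assms
proof (induction vs rule: polyline.induct)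
  case (3 x y)
  then show ?case
    using winding_diff_edge [of x y c] by simp
next
  case (4 x y z zs)
  have join: "winding_number (polyline (x # y # z # zs)) h =
      winding_number (linepath x y) h + winding_number (polyline (y # z # zs)) h" if "h \<in> hex_centers" for h
    using that 4 center_notin_polyline [of "y # z # zs" h] by (simp add: winding_number_join center_notin_edge)
  let ?w = "winding_number (linepath x y)" and ?v = "winding_number (polyline (y # z # zs))"
    and ?d = "c + hex_step 0"
  have "2 * pi * \<i> * ((?w c + ?v c) - (?w ?d + ?v ?d)) = 2 * pi * \<i> * (?w c - ?w ?d) + 2 * pi * \<i> * (?v c - ?v ?d)"
    by (simp add: algebra_simps)
  also have "2 * pi * \<i> * (?w c - ?w ?d) = wall_log c y - wall_log c x + 2 * pi * \<i> * of_int (crossing c x y)"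
    using 4 by (intro winding_diff_edge) auto
  also have "2 * pi * \<i> * (?v c - ?v ?d) = wall_log c (last (y # z # zs)) - wall_log c y
      + 2 * pi * \<i> * of_int (net_crossing c (y # z # zs))"
    using 4 by simp
  finally show ?case
    unfolding join [OF \<open>c \<in> hex_centers\<close>] join [OF add_hex_step_0_center [OF \<open>c \<in> hex_centers\<close>]]
    by (simp add: algebra_simps)
qed auto

text \<open>The discrete Stokes formula: for a closed walk the two \<open>wall_log\<close> terms
  cancel.\<close>

lemma net_crossing_closed:
  assumes "successively hex_edge vs" "c \<in> hex_centers" "length vs \<ge> 2" "last vs = hd vs"
  shows "of_int (net_crossing c vs) = winding_number (polyline vs) c - winding_number (polyline vs) (c + hex_step 0)"
  using winding_diff_polyline [OF assms(1-3)] assms(4) by simp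

subsection \<open>Regions and tilings\<close>

lemma norm_lat_squared: "(norm (lat x y))\<^sup>2 = of_int (x * x + x * y + y * y)"
proof -
  have "(norm (lat x y))\<^sup>2 = (of_int x + of_int y / 2)\<^sup>2 + (of_int y * sqrt 3 / 2)\<^sup>2"
    by (simp add: cmod_power2 Re_lat Im_lat)
  also have "\<dots> = of_int (x * x + x * y + y * y)"
    by (simp add: power_mult_distrib power_divide) (simp add: power2_eq_square field_simps)
  finally show ?thesis .
qed

text \<open>For a difference of centres x = y + 3 m, so its squared norm is 3 k with k an integral
  quadratic form. Norm at most 1 forces k \<le> 0, and completing the square shows that k is
  positive definite.\<close>

lemma hex_centers_separated:
  assumes "c \<in> hex_centers" "h \<in> hex_centers" "dist c h \<le> 1"
  shows "c = h"
proof -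
  obtain x y where d: "h - c = lat x y" and 3: "(x - y) mod 3 = 0"
  proof -
    obtain a b a' b' where "c = lat a b" "(a - b) mod 3 = 0" "h = lat a' b'" "(a' - b') mod 3 = 0"
      using assms(1,2) by (auto simp: hex_centers_lat)
    then show thesis
      by (intro that [of "a' - a" "b' - b"]) (simp_all add: lat_arith, presburger)
  qed
  obtain m where m: "x = y + 3 * m"
    using 3 by (metis add.commute diff_add_cancel dvd_def mod_0_imp_dvd)
  have "norm (lat x y) \<le> 1"
    using assms(3) by (simp add: dist_norm norm_minus_commute flip: d)
  then have "(norm (lat x y))\<^sup>2 \<le> 1"
    by (simp add: power_le_one)
  then have "x * x + x * y + y * y \<le> 1"
    unfolding norm_lat_squared by linarith
  moreover define k where "k = y * y + 3 * m * y + 3 * m * m"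
  moreover have "x * x + x * y + y * y = 3 * k"
    by (simp add: k_def m algebra_simps)
  ultimately have "k \<le> 0"
    by linarith
  moreover have "4 * k = (2 * y + 3 * m)\<^sup>2 + 3 * m\<^sup>2"
    by (simp add: k_def power2_eq_square algebra_simps)
  ultimately have "(2 * y + 3 * m)\<^sup>2 + 3 * m\<^sup>2 \<le> 0"
    by linarith
  moreover have "(2 * y + 3 * m)\<^sup>2 \<ge> 0" "m\<^sup>2 \<ge> 0"
    by simp_all
  ultimately have "m\<^sup>2 = 0" "(2 * y + 3 * m)\<^sup>2 = 0"
    by linarith+
  then have "x = 0" "y = 0"
    using m by auto
  then show ?thesis
    using d by (simp flip: units_eq_lat)
qed

lemma hexagon_subset_cball: "hexagon c \<subseteq> cball c 1"
  unfolding hexagon_def by (intro hull_minimal) (auto simp: hex_corner_def dist_norm)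

lemma center_in_hexagon: "c \<in> hexagon c"
proof -
  have "hex_corner c 0 \<in> hexagon c" "hex_corner c 3 \<in> hexagon c"
    by (auto simp: hexagon_def intro!: hull_inc)
  then have "closed_segment (hex_corner c 0) (hex_corner c 3) \<subseteq> hexagon c"
    unfolding hexagon_def by (metis closed_segment_subset_convex_hull hexagon_def)
  moreover have "midpoint (hex_corner c 0) (hex_corner c 3) = c"
    by (simp add: hex_corner_def midpoint_def)
  ultimately show ?thesis
    by (metis midpoint_in_closed_segment subsetD)
qed

lemma compact_hexagon: "compact (hexagon c)"
  by (simp add: hexagon_def finite_imp_compact_convex_hull)

text \<open>A hexagon lies in the closed unit disc about its centre, which contains no other
  centre.\<close>

lemma center_in_hexagons_iff:
  assumes "S \<subseteq> hex_centers" "h \<in> hex_centers"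
  shows "h \<in> (\<Union>c\<in>S. hexagon c) \<longleftrightarrow> h \<in> S"
proof
  assume "h \<in> (\<Union>c\<in>S. hexagon c)"
  then obtain c where "c \<in> S" "dist c h \<le> 1"
    using hexagon_subset_cball by fastforce
  then show "h \<in> S"
    using hex_centers_separated [of c h] assms by auto
qed (use center_in_hexagon in auto)

lemma hexagon_subset_hexagons_iff:
  assumes "S \<subseteq> hex_centers" "h \<in> hex_centers"
  shows "hexagon h \<subseteq> (\<Union>c\<in>S. hexagon c) \<longleftrightarrow> h \<in> S"
  using center_in_hexagons_iff [OF assms] center_in_hexagon by blast

section \<open>Winding numbers of the boundary loop about the centres\<close>

lemma hex_loop_length:
  assumes "hex_loop vs"
  shows "length vs \<ge> 2"
proof (rule ccontr)
  assume "\<not> length vs \<ge> 2"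
  then obtain x where "vs = [x]"
    using assms by (cases vs) (auto simp: hex_loop_def Suc_le_eq)
  then have "\<forall>s\<in>{0..1::real}. \<forall>t\<in>{0..1}. s = t \<or> s = 0 \<and> t = 1 \<or> s = 1 \<and> t = 0"
    using assms by (simp add: hex_loop_def simple_path_def loop_free_def)
  \<comment> \<open>A one-vertex list gives a constant path, which takes equal values at 1/3 and 2/3
    and so is not simple.\<close>
  from this [THEN bspec, of "1 / 3", THEN bspec, of "2 / 3"] show False
    by simp
qed

text \<open>By the Jordan curve theorem the inside and the outside of the loop are connected; as the
  frontier of \<open>R\<close> is the loop, each lies in \<open>R\<close> or misses it. The outside
  misses the bounded set \<open>R\<close>, and the inside cannot miss it.\<close>

lemma ccw_winding_number:
  assumes "finite S" "S \<subseteq> hex_centers" "R = (\<Union>c\<in>S. hexagon c)" "ccw_traversal R v vs"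
    and h: "h \<in> hex_centers"
  shows "winding_number (polyline vs) h = of_bool (h \<in> S)"
proof -
  let ?P = "path_image (polyline vs)"
  have loop: "hex_loop vs" and P: "?P = frontier R"
    and ccw: "\<And>z. z \<in> inside ?P \<Longrightarrow> winding_number (polyline vs) z = 1"
    using assms(4) by (auto simp: ccw_traversal_def boundary_loop_def)
  then have vs: "vs \<noteq> []" "successively hex_edge vs" and "simple_path (polyline vs)"
    and closed: "pathfinish (polyline vs) = pathstart (polyline vs)"
    by (auto simp: hex_loop_def)
  have notin: "c \<notin> ?P" if "c \<in> hex_centers" for c
    using center_notin_polyline [OF vs(2) that hex_loop_length [OF loop]] .
  have J: "connected (inside ?P)" "connected (outside ?P)" "\<not> bounded (outside ?P)"
    "inside ?P \<inter> ?P = {}" "outside ?P \<inter> ?P = {}" "inside ?P \<union> outside ?P = - ?P"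
    using Jordan_inside_outside [OF \<open>simple_path _\<close> closed]
    by (auto simp: inside_no_overlap outside_no_overlap)
  have "bounded R"
    unfolding assms(3) using assms(1) compact_hexagon by (auto intro: compact_imp_bounded)
  have out: "outside ?P \<inter> R = {}"
  proof (rule ccontr)
    assume "outside ?P \<inter> R \<noteq> {}"
    moreover have "outside ?P - R \<noteq> {}"
      using J(3) \<open>bounded R\<close> bounded_subset by blast
    ultimately have "outside ?P \<inter> frontier R \<noteq> {}"
      using connected_Int_frontier [OF J(2)] by blast
    then show False
      using J(5) P by auto
  qed
  have R_iff: "c \<in> R \<longleftrightarrow> c \<in> S" if "c \<in> hex_centers" for c
    using center_in_hexagons_iff [OF assms(2) that] by (simp add: assms(3))
  show ?thesis
  proof (cases "h \<in> S")
    case True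
    then have "h \<in> inside ?P"
      using notin [OF h] R_iff [OF h] out J(6) by blast
    then show ?thesis
      using ccw True by simp
  next
    case False
    have "h \<notin> inside ?P"
    proof
      assume "h \<in> inside ?P"
      then have "inside ?P - R \<noteq> {}"
        using False R_iff [OF h] by auto
      then have "inside ?P \<inter> R = {}"
        using connected_Int_frontier [OF J(1), of R] J(4) P by blast
      \<comment> \<open>Missing both sides, \<open>R\<close> would lie on the loop, which passes
        through no centre.\<close>
      then have "R \<subseteq> ?P"
        using out J(6) by blast
      moreover have "R \<noteq> {}"
        using P path_image_nonempty [of "polyline vs"] by auto
      then obtain c where "c \<in> S"
        using assms(3) by auto
      ultimately show False
        using R_iff [of c] notin [of c] assms(2) by auto
    qed
    then have "h \<in> outside ?P"
      using J(6) notin [OF h] by blast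
    then show ?thesis
      using False closed by (simp add: winding_number_zero_in_outside)
  qed
qed

section \<open>Colour counts of tiles and of signed-tiled regions\<close>

lemma hex_steps_cases:
  assumes "u \<in> hex_steps"
  obtains x y where "u = lat x y" "(x - y) mod 3 = 0" "y mod 3 \<noteq> 0"
  using assms by (force simp: hex_steps_lat)

text \<open>Each step changes the colour, whereas two steps at 60 degrees together restore it. The
  last clause says u + w is not 0, which keeps the hexagons of a snake apart.\<close>

lemma angle60_cases:
  assumes "angle60 u w"
  obtains x y x' y' where "u = lat x y" "w = lat x' y'" "(x - y) mod 3 = 0" "(x' - y') mod 3 = 0"
    "y mod 3 \<noteq> 0" "(y + y') mod 3 = 0" "x + x' \<noteq> 0 \<or> y + y' \<noteq> 0"
proof -
  have zeta: "cis (pi / 3) * lat x y = lat (- y) (x + y)" for x y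
    by (simp add: units_eq_lat lat_mult)
  from assms have "u \<in> hex_steps" "w \<in> hex_steps" and "w = cis (pi / 3) * u \<or> u = cis (pi / 3) * w"
    by (auto simp: angle60_def)
  from this(3) show thesis
  proof
    assume w: "w = cis (pi / 3) * u"
    obtain x y where u: "u = lat x y" and *: "(x - y) mod 3 = 0" "y mod 3 \<noteq> 0"
      using hex_steps_cases [OF \<open>u \<in> hex_steps\<close>] .
    have "(- y - (x + y)) mod 3 = 0" "(y + (x + y)) mod 3 = 0" "x + - y \<noteq> 0 \<or> y + (x + y) \<noteq> 0"
      using * by presburger+
    then show thesis
      using that [OF u _ *(1) _ *(2)] w by (simp add: u zeta)
  next
    assume u: "u = cis (pi / 3) * w"
    obtain x y where w: "w = lat x y" and *: "(x - y) mod 3 = 0" "y mod 3 \<noteq> 0"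
      using hex_steps_cases [OF \<open>w \<in> hex_steps\<close>] .
    have "(- y - (x + y)) mod 3 = 0" "(x + y) mod 3 \<noteq> 0" "(x + y + y) mod 3 = 0" "- y + x \<noteq> 0 \<or> x + y + y \<noteq> 0"
      using * by presburger+
    then show thesis
      using that [OF _ w _ *(1), of "- y" "x + y"] by (simp add: u w zeta)
  qed
qed

lemma card_filter_eq_sum: "finite T \<Longrightarrow> card {h \<in> T. P h} = (\<Sum>h\<in>T. of_bool (P h))"
  by (simp add: Collect_conj_eq)

lemma three_colours_even:
  fixes i j k m :: int
  assumes "i mod 3 \<noteq> j mod 3" "j mod 3 \<noteq> k mod 3" "k mod 3 \<noteq> i mod 3"
  shows "even (of_bool (i mod 3 \<noteq> m mod 3) + (of_bool (j mod 3 \<noteq> m mod 3) + of_bool (k mod 3 \<noteq> m mod 3)) :: nat)"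
proof -
  have "m mod 3 = i mod 3 \<or> m mod 3 = j mod 3 \<or> m mod 3 = k mod 3"
    using assms by presburger
  then show ?thesis
    using assms by auto
qed

lemma double_lat: "2 * lat x y = lat (x + x) (y + y)"
  by (simp only: mult_2 lat_arith)

text \<open>Modulo 3 the rows are b, b + y, b + 2 y for a bone and b, b + y, b - y for a stone, with
  y not divisible by 3: all residues occur once. A snake has rows b, b + y, b, b + y.\<close>

lemma tile_properties:
  assumes "T \<in> stones \<union> bones \<union> snakes"
  shows "finite T \<and> T \<subseteq> hex_centers \<and> even (card {h \<in> T. lat_row h mod 3 \<noteq> m mod 3})"
proof -
  consider (bone) p u where "T = {p, p + u, p + 2 * u}" "p \<in> hex_centers" "u \<in> hex_steps"
    | (stone) p u w where "T = {p, p + u, p + w}" "p \<in> hex_centers" "angle60 u w"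
    | (snake) p u w where "T = {p, p + u, p + u + w, p + 2 * u + w}" "p \<in> hex_centers" "angle60 u w"
    using assms by (auto simp: stones_def bones_def snakes_def)
  then show ?thesis
  proof cases
    case bone
    obtain a b where p: "p = lat a b" and ab: "(a - b) mod 3 = 0"
      using bone(2) by (auto simp: hex_centers_lat)
    obtain x y where u: "u = lat x y" and xy: "(x - y) mod 3 = 0" "y mod 3 \<noteq> 0"
      using hex_steps_cases [OF bone(3)] .
    have T: "T = {lat a b, lat (a + x) (b + y), lat (a + (x + x)) (b + (y + y))}"
      by (simp only: bone(1) p u double_lat lat_arith)
    have "b mod 3 \<noteq> (b + y) mod 3" "(b + y) mod 3 \<noteq> (b + (y + y)) mod 3" "(b + (y + y)) mod 3 \<noteq> b mod 3"
      using xy by presburger+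
    note even = three_colours_even [OF this, of m]
    have "y \<noteq> 0" "(a + x - (b + y)) mod 3 = 0" "(a + (x + x) - (b + (y + y))) mod 3 = 0"
      using ab xy by presburger+
    then show ?thesis
      using even ab by (subst card_filter_eq_sum) (simp_all add: T lat_eq_iff hex_centers_lat del: sum_of_bool_eq)
  next
    case stone
    obtain a b where p: "p = lat a b" and ab: "(a - b) mod 3 = 0"
      using stone(2) by (auto simp: hex_centers_lat)
    obtain x y x' y' where u: "u = lat x y" and w: "w = lat x' y'"
      and xy: "(x - y) mod 3 = 0" "(x' - y') mod 3 = 0" "y mod 3 \<noteq> 0" "(y + y') mod 3 = 0"
      by (rule angle60_cases [OF stone(3)])
    have T: "T = {lat a b, lat (a + x) (b + y), lat (a + x') (b + y')}"
      by (simp only: stone(1) p u w lat_arith)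
    have "b mod 3 \<noteq> (b + y) mod 3" "(b + y) mod 3 \<noteq> (b + y') mod 3" "(b + y') mod 3 \<noteq> b mod 3"
      using xy by presburger+
    note even = three_colours_even [OF this, of m]
    have "y \<noteq> 0" "y' \<noteq> 0" "y \<noteq> y'" "(a + x - (b + y)) mod 3 = 0" "(a + x' - (b + y')) mod 3 = 0"
      using ab xy by presburger+
    then show ?thesis
      using even ab by (subst card_filter_eq_sum) (simp_all add: T lat_eq_iff hex_centers_lat del: sum_of_bool_eq)
  next
    case snake
    obtain a b where p: "p = lat a b" and ab: "(a - b) mod 3 = 0"
      using snake(2) by (auto simp: hex_centers_lat)
    obtain x y x' y' where u: "u = lat x y" and w: "w = lat x' y'"
      and xy: "(x - y) mod 3 = 0" "(x' - y') mod 3 = 0" "y mod 3 \<noteq> 0" "(y + y') mod 3 = 0"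
      and ne: "x + x' \<noteq> 0 \<or> y + y' \<noteq> 0"
      using angle60_cases [OF snake(3)] .
    have T: "T = {lat a b, lat (a + x) (b + y), lat (a + (x + x')) (b + (y + y')),
        lat (a + (x + (x + x'))) (b + (y + (y + y')))}"
      by (simp only: snake(1) p u w double_lat lat_arith add.assoc)
    have rows: "(b + (y + y')) mod 3 = b mod 3" "(b + (y + (y + y'))) mod 3 = (b + y) mod 3"
      using xy by presburger+
    \<comment> \<open>Tiles are sets, so counting needs four distinct centres. The rows separate all
      pairs except those differing by u + w, which \<open>ne\<close> separates.\<close>
    have "y \<noteq> 0" "y' \<noteq> 0" "y + (y + y') \<noteq> 0"
      using xy by presburger+
    with ne have distinct: "lat a b \<noteq> lat (a + x) (b + y)" "lat a b \<noteq> lat (a + (x + x')) (b + (y + y'))"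
      "lat a b \<noteq> lat (a + (x + (x + x'))) (b + (y + (y + y')))"
      "lat (a + x) (b + y) \<noteq> lat (a + (x + x')) (b + (y + y'))"
      "lat (a + x) (b + y) \<noteq> lat (a + (x + (x + x'))) (b + (y + (y + y')))"
      "lat (a + (x + x')) (b + (y + y')) \<noteq> lat (a + (x + (x + x'))) (b + (y + (y + y')))"
      unfolding lat_eq_iff by linarith+
    have centers: "(a + x - (b + y)) mod 3 = 0" "(a + (x + x') - (b + (y + y'))) mod 3 = 0"
      "(a + (x + (x + x')) - (b + (y + (y + y')))) mod 3 = 0"
      using ab xy by presburger+
    have "finite T"
      by (simp add: T)
    moreover have "T \<subseteq> hex_centers"
      using ab centers by (auto simp: T hex_centers_lat lat_eq_iff)
    moreover have "(\<Sum>h\<in>T. of_bool (lat_row h mod 3 \<noteq> m mod 3) :: nat) =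
        of_bool (b mod 3 \<noteq> m mod 3) + (of_bool ((b + y) mod 3 \<noteq> m mod 3)
          + (of_bool (b mod 3 \<noteq> m mod 3) + of_bool ((b + y) mod 3 \<noteq> m mod 3)))"
      unfolding T using distinct
      by (simp only: sum.insert finite.intros insert_iff empty_iff sum.empty lat_row_lat rows simp_thms add_0_right)
    ultimately show ?thesis
      by (simp add: card_filter_eq_sum del: sum_of_bool_eq)
  qed
qed

lemma even_sum_sum_mset:
  fixes f :: "'a \<Rightarrow> 'b \<Rightarrow> int"
  assumes "\<And>t. t \<in># M \<Longrightarrow> even (\<Sum>h\<in>A. f t h)"
  shows "even (\<Sum>h\<in>A. \<Sum>t\<in>#M. f t h)"
  using assms by (induction M) (auto simp: sum.distrib)

text \<open>Double counting: the total weight over the hexagons counted is their number in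
  \<open>S\<close>, and summed tile by tile it is a combination of even numbers.\<close>

lemma even_card_signed_tiling:
  assumes tiling: "signed_tiling \<T> R" and S: "finite S" "S \<subseteq> hex_centers" "R = (\<Union>c\<in>S. hexagon c)"
  shows "even (card {h \<in> S. lat_row h mod 3 \<noteq> m mod 3})"
proof -
  let ?P = "\<lambda>h. lat_row h mod 3 \<noteq> m mod 3"
  \<comment> \<open>Outside \<open>S\<close> the weights cancel but tiles may still lie there, so
    the sum runs over a finite set containing \<open>S\<close> and every tile.\<close>
  define U where "U = S \<union> (\<Union>(T, \<epsilon>)\<in>set_mset \<T>. T)"
  have tile: "finite T" "T \<subseteq> hex_centers" "even (card {h \<in> T. ?P h})" "T \<subseteq> U" if "(T, \<epsilon>) \<in># \<T>" for T \<epsilon>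
  proof -
    have "T \<in> stones \<union> bones \<union> snakes"
      using that tiling by (auto simp: signed_tiling_def)
    from tile_properties [OF this, of m]
    show "finite T" "T \<subseteq> hex_centers" "even (card {h \<in> T. ?P h})"
      by auto
    show "T \<subseteq> U"
      using that by (auto simp: U_def)
  qed
  have U: "finite U" "S \<subseteq> U"
    using S(1) tile(1) by (auto simp: U_def)
  have "U \<subseteq> hex_centers"
    unfolding U_def
  proof (intro Un_least S(2) UN_least)
    fix t assume "t \<in># \<T>"
    then show "(case t of (T, \<epsilon>) \<Rightarrow> T) \<subseteq> hex_centers"
      using tile(2) by (cases t) simp
  qed
  have "even (\<Sum>h\<in>{h\<in>U. ?P h}. \<Sum>(T, \<epsilon>)\<in>#\<T>. if h \<in> T then \<epsilon> else 0)"
    unfolding case_prod_beta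
  proof (rule even_sum_sum_mset)
    fix t assume t: "t \<in># \<T>"
    obtain T \<epsilon> where t': "t = (T, \<epsilon>)"
      by fastforce
    have "(\<Sum>h\<in>{h\<in>U. ?P h}. if h \<in> T then \<epsilon> else 0) = (\<Sum>h\<in>{h\<in>T. ?P h}. \<epsilon>)"
      using U(1) tile(4) t t' by (intro sum.mono_neutral_cong_right) auto
    then show "even (\<Sum>h\<in>{h\<in>U. ?P h}. if h \<in> fst t then snd t else 0)"
      unfolding t' fst_conv snd_conv using tile(3) t t' by simp
  qed
  also have "(\<Sum>h\<in>{h\<in>U. ?P h}. \<Sum>(T, \<epsilon>)\<in>#\<T>. if h \<in> T then \<epsilon> else 0) = (\<Sum>h\<in>{h\<in>U. ?P h}. of_bool (h \<in> S))"
  proof (rule sum.cong [OF refl])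
    fix h assume "h \<in> {h\<in>U. ?P h}"
    then have "h \<in> hex_centers"
      using \<open>U \<subseteq> hex_centers\<close> by auto
    then show "(\<Sum>(T, \<epsilon>)\<in>#\<T>. if h \<in> T then \<epsilon> else 0) = of_bool (h \<in> S)"
      using tiling hexagon_subset_hexagons_iff [OF S(2)] by (simp add: signed_tiling_def S(3))
  qed
  also have "\<dots> = (\<Sum>h\<in>{h\<in>S. ?P h}. 1)"
    using U by (intro sum.mono_neutral_cong_right) auto
  finally show ?thesis
    by simp
qed

lemma center_diff_hex_step_0:
  assumes "c \<in> hex_centers"
  shows "c - hex_step 0 \<in> hex_centers" "lat_row (c - hex_step 0) = lat_row c - 1"
  using assms by (force simp: hex_centers_lat hex_step_0 lat_arith lat_eq_iff)+

text \<open>Subtracting \<open>hex_step 0\<close> lowers the row by 1, so the shifted indicators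
  count the hexagons of \<open>S\<close> whose row avoids the residue of m + 1; the sum is a
  difference of two even counts.\<close>

lemma even_sum_differences:
  assumes S: "S \<subseteq> hex_centers" and "finite F" "S \<subseteq> F" "(\<lambda>c. c - hex_step 0) ` S \<subseteq> F"
    and n: "\<And>c. c \<in> F \<Longrightarrow> n c = of_bool (c \<in> S) - (of_bool (c + hex_step 0 \<in> S) :: int)"
    and even: "\<And>m. even (card {h \<in> S. lat_row h mod 3 \<noteq> m mod 3})"
  shows "even (\<Sum>c\<in>{c\<in>F. lat_row c mod 3 \<noteq> m mod 3}. n c)"
proof -
  let ?P = "\<lambda>m c. lat_row c mod 3 \<noteq> m mod 3"
  have "(\<Sum>c\<in>{c\<in>F. ?P m c}. of_bool (c \<in> S)) = (\<Sum>c\<in>{c\<in>S. ?P m c}. 1 :: int)"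
    using assms(2,3) by (intro sum.mono_neutral_cong_right) auto
  moreover have "(\<Sum>c\<in>{c\<in>F. ?P m c}. of_bool (c + hex_step 0 \<in> S)) =
      (\<Sum>c\<in>(\<lambda>c. c - hex_step 0) ` {c\<in>S. ?P (m + 1) c}. 1 :: int)"
  proof (intro sum.mono_neutral_cong_right ballI)
    have shift: "?P m (c - hex_step 0) \<longleftrightarrow> ?P (m + 1) c" if "c \<in> S" for c
    proof -
      have "lat_row (c - hex_step 0) = lat_row c - 1"
        using that S center_diff_hex_step_0 by auto
      then show ?thesis
        by presburger
    qed
    show "finite {c\<in>F. ?P m c}"
      using \<open>finite F\<close> by simp
    show "(\<lambda>c. c - hex_step 0) ` {c\<in>S. ?P (m + 1) c} \<subseteq> {c\<in>F. ?P m c}"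
      using assms(4) shift by auto
    fix c
    show "of_bool (c + hex_step 0 \<in> S) = (0 :: int)"
      if "c \<in> {c\<in>F. ?P m c} - (\<lambda>c. c - hex_step 0) ` {c\<in>S. ?P (m + 1) c}"
      using that shift [of "c + hex_step 0"] by (auto simp: image_iff)
    show "of_bool (c + hex_step 0 \<in> S) = (1 :: int)"
      if "c \<in> (\<lambda>c. c - hex_step 0) ` {c\<in>S. ?P (m + 1) c}"
      using that by auto
  qed
  moreover have "card ((\<lambda>c. c - hex_step 0) ` {c\<in>S. ?P (m + 1) c}) = card {c\<in>S. ?P (m + 1) c}"
    by (intro card_image inj_onI) simp
  moreover have "(\<Sum>c\<in>{c\<in>F. ?P m c}. n c) =
      (\<Sum>c\<in>{c\<in>F. ?P m c}. of_bool (c \<in> S)) - (\<Sum>c\<in>{c\<in>F. ?P m c}. of_bool (c + hex_step 0 \<in> S))"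
    unfolding sum_subtractf [symmetric] using n by (intro sum.cong) auto
  ultimately show ?thesis
    using even [of m] even [of "m + 1"] by simp
qed

theorem mainTheorem2:
  fixes \<omega> v :: complex and R :: "complex set" and vs :: "complex list"
  assumes "primitive_root_of_unity 12 \<omega>"
    and "hex_region R"
    and "\<exists>\<T>. signed_tiling \<T> R"
    and "ccw_traversal R v vs"
  shows "walk_matrix \<omega> vs = mat 1 \<or> walk_matrix \<omega> vs = - mat 1"
proof -
  obtain S where S: "finite S" "S \<subseteq> hex_centers" "R = (\<Union>c\<in>S. hexagon c)"
    using assms(2) by (auto simp: hex_region_def)
  obtain \<T> where \<T>: "signed_tiling \<T> R"
    using assms(3) by blast
  have loop: "hex_loop vs"
    using assms(4) by (auto simp: ccw_traversal_def boundary_loop_def)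
  then have vs: "vs \<noteq> []" "successively hex_edge vs" "last vs = hd vs" "length vs \<ge> 2"
    using hex_loop_length by (auto simp: hex_loop_def)
  \<comment> \<open>The first two parts contain every centre where the difference of indicators can
    be nonzero; the third contains the centre attached to each \<beta> edge of the walk.\<close>
  define F where "F = S \<union> (\<lambda>c. c - hex_step 0) ` S \<union> ((\<lambda>z. z - 1) ` set vs \<inter> hex_centers)"
  have F: "finite F" "F \<subseteq> hex_centers"
    using S center_diff_hex_step_0 by (auto simp: F_def)
  have n: "net_crossing c vs = of_bool (c \<in> S) - of_bool (c + hex_step 0 \<in> S)" if "c \<in> F" for c
  proof -
    have c: "c \<in> hex_centers" "c + hex_step 0 \<in> hex_centers"
      using that F(2) add_hex_step_0_center by auto
    have "(of_int (net_crossing c vs) :: complex) = of_int (of_bool (c \<in> S) - of_bool (c + hex_step 0 \<in> S))"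
      using net_crossing_closed [OF vs(2) c(1) vs(4,3)]
      by (simp add: ccw_winding_number [OF S assms(4)] c)
    then show ?thesis
      by (simp only: of_int_eq_iff)
  qed
  have even: "even (\<Sum>c\<in>{c\<in>F. lat_row c mod 3 \<noteq> m mod 3}. net_crossing c vs)" for m
    using even_card_signed_tiling [OF \<T> S] n
    by (intro even_sum_differences [OF S(2) F(1)]) (auto simp: F_def)
  \<comment> \<open>The residues 1 and 2 are those left out by the two exponents of
    \<open>defect\<close>.\<close>
  have "walk_matrix \<omega> vs \<simeq> mat 1"
    using even [of 1] even [of 2] vs
    by (intro closed_walk_matrix [OF primitive_root_12 [OF assms(1)] F(1)]) (auto simp: F_def)
  then show ?thesis
    by (simp add: eq_upto_sign_def)
qed

end
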